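(* Consider the multi-converter power system $\dot z=f(z,u)$ with state $z=(\gamma,\tilde v_{dc},i,v,i_\ell)\in\mathcal X=\mathbb T^n\times\mathbb R^n\times\mathbb R^{2n}\times\mathbb R^{2n}\times\mathbb R^{2m}$ (defined in the context), with a feasible input $\mathbf u\in\mathcal U$. Let $z^*=(\gamma^*,0,x^* )\in\mathcal M$, where $\mathcal M=\{z^*\in\mathcal X: f(z^*,u)=0\}$, and assume that the Jacobian $J_f(z^* )=\frac{\partial f}{\partial z}\big|_{z=z^*}$ has only one eigenvalue at zero and that all its other eigenvalues have real part in the open left half-plane. Then the set $$\mathcal S(z^* )=\{(\gamma^*+\theta\mathds{1}_n,\;0,\;\mathbf R(\theta)x^* ):\theta\in\mathbb S^1\}$$ is locally asymptotically stable with respect to $\dot z=f(z,u)$. Moreover, there exists a neighborhood $\mathcal D$ of $\mathcal S(z^* )$ such that for every $z(0)\in\mathcal D$ there exists a point $s\in\mathcal S(z^* )$ with $\lim_{t\to\infty}z(t)=s$.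
   Context: Graph: an undirected graph with $n$ nodes and $m$ edges, arbitrary topology, with (arbitrarily oriented) incidence matrix $\mathcal B\in\mathbb R^{n\times m}$ (entries in $\{-1,0,1\}$); $\mathbf B=\mathcal B\otimes I_2$. Notation: $\mathbf I$ is an identity matrix of suitable size, $J_2=\begin{bmatrix}0&-1\\1&0\end{bmatrix}$, $\mathbf J=\mathbf I\otimes J_2$, $R(\theta)=\begin{bmatrix}\cos\theta&-\sin\theta\\ \sin\theta&\cos\theta\end{bmatrix}$, $\mathbf R(\theta)=\mathbf I\otimes R(\theta)$, $r(\gamma_k)=(-\sin\gamma_k,\cos\gamma_k)^\top$, and $\mathrm{Rot}(\gamma)\in\mathbb R^{2n\times n}$ is the block-diagonal matrix with $k$-th diagonal block $r(\gamma_k)$. $\mathds 1_n$ is the all-ones vector; $\mathbb T^n=(\mathbb S^1)^n$. Constants: $\eta,C_{dc},K_p,L,C,R,G,R_\ell,L_\ell,\omega^*,v_{dc}^*>0$ and $\mu\in(0,1)$. Put $Z_R=R\,\mathbf I+L\omega^*\mathbf J$, $Z_C=G\,\mathbf I+C\omega^*\mathbf J$, $Z_\ell=R_\ell\mathbf I+L_\ell\omega^*\mathbf J$. Dynamics ($n$ identical DC/AC converters under matching control, $m$ identical RL lines): with $\tilde v_{dc}=v_{dc}-v_{dc}^*\mathds 1_n$ and $x=(i,v,i_\ell)$, $\dot z=f(z,u)$ is $$\dot\gamma=\eta\tilde v_{dc},\quad C_{dc}\dot{\tilde v}_{dc}=-K_p\tilde v_{dc}-\tfrac12\mu\,\mathrm{Rot}(\gamma)^\top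 i+\mathbf u,$$ $$L\dot i=-Z_R i+\tfrac12\mu\,\mathrm{Rot}(\gamma)(\tilde v_{dc}+v_{dc}^*\mathds 1_n)-v,\quad C\dot v=-Z_C v+i-\mathbf B i_\ell,\quad L_\ell\dot i_\ell=-Z_\ell i_\ell+\mathbf B^\top v,$$ where $\mathbf u\in\mathbb R^n$ is a constant input and $u$ denotes $\mathbf u$ placed in the $\tilde v_{dc}$ component (zero elsewhere). Feasible inputs: $\mathcal U$ is the set of all $\mathbf u$ of the form $\mathbf u=\xi\,\mathrm{Rot}(\gamma^* )^\top Y\,\mathrm{Rot}(\gamma^* )\mathds 1_n$ with $\gamma^*\in\mathbb T^n$, $\xi=\mu^2v_{dc}^*/4$, $Y=(Z_R+(Z_C+\mathbf B Z_\ell^{-1}\mathbf B^\top)^{-1})^{-1}$. Set stability: with $d$ a distance metric and $d(z,\mathcal K)=\inf_{x\in\mathcal K}d(z,x)$, a set $\mathcal K$ is stable if for all $\epsilon>0$ there is $\delta>0$ such that $d(z_0,\mathcal K)\le\delta$ implies $d(z(t,z_0),\mathcal K)<\epsilon$ for all $t\ge0$; it is (locally) asymptotically stable if it is stable and $\lim_{t\to\infty}d(z(t,z_0),\mathcal K)=0$ (for all $z_0$ in a neighborhood of $\mathcal K$). *)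

theory Defs
  imports "HOL-Analysis.Analysis" "HOL-Computational_Algebra.Polynomial"
begin

section \<open>The circle\<close>

text \<open>The circle is the unit circle of the complex plane with the chordal metric; its group law
  (multiplication of complex numbers) is written additively, as addition of angles.\<close>

typedef circle = "sphere (0::complex) 1"
  morphisms unit_complex Abs_circle
  by (rule exI[of _ 1]) simp

lemma norm_unit_complex [simp]: "norm (unit_complex a) = 1"
  using unit_complex[of a] by simp

instantiation circle :: metric_space
begin

definition dist_circle :: "circle \<Rightarrow> circle \<Rightarrow> real"
  where "dist_circle a b = dist (unit_complex a) (unit_complex b)"

definition uniformity_circle :: "(circle \<times> circle) filter"
  where "uniformity_circle = (INF e\<in>{0<..}. principal {(a, b). dist a b < e})"

definition open_circle :: "circle set \<Rightarrow> bool"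
  where "open_circle U = (\<forall>a\<in>U. eventually (\<lambda>(a', b). a' = a \<longrightarrow> b \<in> U) uniformity)"

instance
proof
  fix a b c :: circle
  show "dist a b = 0 \<longleftrightarrow> a = b"
    by (simp add: dist_circle_def unit_complex_inject)
  show "dist a b \<le> dist a c + dist b c"
    by (simp add: dist_circle_def dist_triangle2)
qed (simp_all only: uniformity_circle_def open_circle_def)

end

instantiation circle :: ab_group_add
begin

definition zero_circle :: circle
  where "0 = Abs_circle 1"

definition plus_circle :: "circle \<Rightarrow> circle \<Rightarrow> circle"
  where "a + b = Abs_circle (unit_complex a * unit_complex b)"

definition uminus_circle :: "circle \<Rightarrow> circle"
  where "- a = Abs_circle (inverse (unit_complex a))"

definition minus_circle :: "circle \<Rightarrow> circle \<Rightarrow> circle"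
  where "a - b = Abs_circle (unit_complex a / unit_complex b)"

instance
proof
  fix a b c :: circle
  have nz: "unit_complex x \<noteq> 0" for x
    using norm_unit_complex[of x] by (metis norm_zero zero_neq_one)
  have Z: "unit_complex 0 = 1"
    by (simp add: zero_circle_def Abs_circle_inverse)
  have P: "unit_complex (x + y) = unit_complex x * unit_complex y" for x y
    by (simp add: plus_circle_def Abs_circle_inverse norm_mult)
  have U: "unit_complex (- x) = inverse (unit_complex x)" for x
    by (simp add: uminus_circle_def Abs_circle_inverse norm_inverse)
  have M: "unit_complex (x - y) = unit_complex x / unit_complex y" for x y
    by (simp add: minus_circle_def Abs_circle_inverse norm_divide)
  show "a + b + c = a + (b + c)" "a + b = b + a" "0 + a = a" "- a + a = 0" "a - b = a + - b"
    using nz by (simp_all add: unit_complex_inject[symmetric] Z P U M divide_inverse)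
qed

end

definition ang :: "real \<Rightarrow> circle"
  where "ang x = Abs_circle (cis x)"

definition ccos :: "circle \<Rightarrow> real"
  where "ccos a = Re (unit_complex a)"

definition csin :: "circle \<Rightarrow> real"
  where "csin a = Im (unit_complex a)"

lemma unit_complex_ang [simp]: "unit_complex (ang x) = cis x"
  by (simp add: ang_def Abs_circle_inverse)

lemma ccos_ang [simp]: "ccos (ang x) = cos x" and csin_ang [simp]: "csin (ang x) = sin x"
  by (simp_all add: ccos_def csin_def)

lemma ang_add: "ang (x + y) = ang x + ang y"
  by (simp add: unit_complex_inject[symmetric] plus_circle_def Abs_circle_inverse norm_mult cis_mult)

lemma surj_ang: "surj ang"
proof (rule surjI)
  show "ang (Arg (unit_complex a)) = a" for a
    by (simp add: unit_complex_inject[symmetric] cis_Arg sgn_eq)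
       (metis cis_Arg norm_unit_complex norm_zero sgn_eq div_by_1 of_real_1 zero_neq_one)
qed


section \<open>Matrices\<close>

definition kron :: "real^'b^'a \<Rightarrow> real^'d^'c \<Rightarrow> real^('b \<times> 'd)^('a \<times> 'c)"  (infixl "\<otimes>\<^sub>K" 75)
  where "A \<otimes>\<^sub>K B = (\<chi> p q. A $ fst p $ fst q * B $ snd p $ snd q)"

definition J2 :: "real^2^2"
  where "J2 = vector [vector [0, -1], vector [1, 0]]"

definition rot2 :: "circle \<Rightarrow> real^2^2"
  where "rot2 \<theta> = vector [vector [ccos \<theta>, - csin \<theta>], vector [csin \<theta>, ccos \<theta>]]"

definition JJ :: "real^('k::finite \<times> 2)^('k \<times> 2)"
  where "JJ = mat 1 \<otimes>\<^sub>K J2"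

definition RR :: "circle \<Rightarrow> real^('k::finite \<times> 2)^('k \<times> 2)"
  where "RR \<theta> = mat 1 \<otimes>\<^sub>K rot2 \<theta>"

definition rvec :: "circle \<Rightarrow> real^2"
  where "rvec a = vector [- csin a, ccos a]"

definition Rot :: "circle^'n \<Rightarrow> real^'n^('n \<times> 2)"
  where "Rot \<gamma> = (\<chi> p k. if fst p = k then rvec (\<gamma> $ k) $ snd p else 0)"

text \<open>Column \<open>e\<close> of an incidence matrix: the line \<open>e\<close> joins the distinct nodes \<open>i\<close> and \<open>j\<close>.
  Parallel lines are not excluded.\<close>

definition incidence_matrix :: "real^'m^'n \<Rightarrow> bool"
  where "incidence_matrix \<B> \<longleftrightarrow>
    (\<forall>e. \<exists>i j. i \<noteq> j \<and> (\<forall>k. \<B> $ k $ e = (if k = i then 1 else if k = j then -1 else 0)))"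

definition eigenvalue :: "real^'k^'k \<Rightarrow> complex \<Rightarrow> bool"
  where "eigenvalue A l \<longleftrightarrow>
    (\<exists>v::complex^'k. v \<noteq> 0 \<and> map_matrix complex_of_real A *v v = l *s v)"

definition charpoly :: "real^'k^'k \<Rightarrow> complex poly"
  where "charpoly A =
    det (\<chi> i j. (if i = j then [:0, 1:] else 0) - [:complex_of_real (A $ i $ j):])"

definition alg_mult :: "real^'k^'k \<Rightarrow> complex \<Rightarrow> nat"
  where "alg_mult A l = order l (charpoly A)"


section \<open>The converter network\<close>

record params =
  eta :: real
  C_dc :: real
  K_p :: real
  mu :: real
  v_ref :: real  \<comment> \<open>\<open>v\<^sub>d\<^sub>c\<^sup>*\<close>\<close>
  omega :: real  \<comment> \<open>\<open>\<omega>\<^sup>*\<close>\<close>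
  R_f :: real
  L_f :: real
  G_f :: real
  C_f :: real
  R_l :: real
  L_l :: real

definition admissible :: "params \<Rightarrow> bool"
  where "admissible P \<longleftrightarrow>
    eta P > 0 \<and> C_dc P > 0 \<and> K_p P > 0 \<and> 0 < mu P \<and> mu P < 1 \<and> v_ref P > 0 \<and> omega P > 0 \<and>
    R_f P > 0 \<and> L_f P > 0 \<and> G_f P > 0 \<and> C_f P > 0 \<and> R_l P > 0 \<and> L_l P > 0"

text \<open>\<open>mat r\<close> is \<open>r\<close> times the identity.\<close>

definition Z_R :: "params \<Rightarrow> real^('n::finite \<times> 2)^('n \<times> 2)"
  where "Z_R P = mat (R_f P) + (L_f P * omega P) *\<^sub>R JJ"

definition Z_C :: "params \<Rightarrow> real^('n::finite \<times> 2)^('n \<times> 2)"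
  where "Z_C P = mat (G_f P) + (C_f P * omega P) *\<^sub>R JJ"

definition Z_l :: "params \<Rightarrow> real^('m::finite \<times> 2)^('m \<times> 2)"
  where "Z_l P = mat (R_l P) + (L_l P * omega P) *\<^sub>R JJ"

definition BB :: "real^'m^'n \<Rightarrow> real^('m \<times> 2)^('n \<times> 2)"
  where "BB \<B> = \<B> \<otimes>\<^sub>K (mat 1 :: real^2^2)"

definition admittance :: "params \<Rightarrow> real^'m^'n \<Rightarrow> real^('n \<times> 2)^('n \<times> 2)"
  where "admittance P \<B> =
    matrix_inv (Z_R P + matrix_inv (Z_C P + BB \<B> ** matrix_inv (Z_l P) ** transpose (BB \<B>)))"

definition feasible_inputs :: "params \<Rightarrow> real^'m^'n \<Rightarrow> (real^'n) set"
  where "feasible_inputs P \<B> =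
    {((mu P)\<^sup>2 * v_ref P / 4) *\<^sub>R
       (transpose (Rot \<gamma>) *v (admittance P \<B> *v (Rot \<gamma> *v 1))) | \<gamma>. True}"

type_synonym ('n, 'm) state =
  "(circle^'n) \<times> (real^'n) \<times> (real^('n \<times> 2)) \<times> (real^('n \<times> 2)) \<times> (real^('m \<times> 2))"

text \<open>Tangent vectors of the state space; also the states of its universal cover, where the
  angles are real numbers.\<close>

type_synonym ('n, 'm) tangent =
  "(real^'n) \<times> (real^'n) \<times> (real^('n \<times> 2)) \<times> (real^('n \<times> 2)) \<times> (real^('m \<times> 2))"

text \<open>The second component \<open>w\<close> of a state is the deviation of the DC voltage from its reference.\<close>

fun vf :: "params \<Rightarrow> real^'m^'n \<Rightarrow> real^'n \<Rightarrow> ('n, 'm) state \<Rightarrow> ('n, 'm) tangent"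
  where "vf P \<B> u (\<gamma>, w, i, v, l) =
   (eta P *\<^sub>R w,
    (1 / C_dc P) *\<^sub>R (- (K_p P *\<^sub>R w) - (mu P / 2) *\<^sub>R (transpose (Rot \<gamma>) *v i) + u),
    (1 / L_f P) *\<^sub>R (- (Z_R P *v i) + (mu P / 2) *\<^sub>R (Rot \<gamma> *v (w + v_ref P *\<^sub>R 1)) - v),
    (1 / C_f P) *\<^sub>R (- (Z_C P *v v) + i - BB \<B> *v l),
    (1 / L_l P) *\<^sub>R (- (Z_l P *v l) + transpose (BB \<B>) *v v))"

definition equilibria :: "params \<Rightarrow> real^'m^'n \<Rightarrow> real^'n \<Rightarrow> ('n, 'm) state set"
  where "equilibria P \<B> u = {z. vf P \<B> u z = 0}"

fun cover :: "('n::finite, 'm::finite) tangent \<Rightarrow> ('n, 'm) state"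
  where "cover (g, w, i, v, l) = (\<chi> k. ang (g $ k), w, i, v, l)"

text \<open>A curve on the state space has velocity \<open>h\<close> if a lift of it to the universal cover does.
  Solutions are considered on the time interval \<open>{0..}\<close>; values at negative times are irrelevant.\<close>

definition solution ::
  "params \<Rightarrow> real^'m^'n \<Rightarrow> real^'n \<Rightarrow> (real \<Rightarrow> ('n::finite, 'm::finite) state) \<Rightarrow> bool"
  where "solution P \<B> u z \<longleftrightarrow>
    (\<exists>y. \<forall>t\<ge>0. z t = cover (y t) \<and>
                (y has_vector_derivative vf P \<B> u (z t)) (at t within {0..}))"

fun coords :: "('n::finite, 'm::finite) tangent \<Rightarrow> real^('n + 'n + ('n \<times> 2) + ('n \<times> 2) + ('m \<times> 2))"
  where "coords (g, w, i, v, l) =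
    (\<chi> s. case s of Inl k \<Rightarrow> g $ k | Inr s \<Rightarrow> (case s of Inl k \<Rightarrow> w $ k
       | Inr s \<Rightarrow> (case s of Inl p \<Rightarrow> i $ p | Inr s \<Rightarrow> (case s of Inl p \<Rightarrow> v $ p | Inr q \<Rightarrow> l $ q))))"

definition of_coords ::
  "real^('n::finite + 'n + ('n \<times> 2) + ('n \<times> 2) + ('m::finite \<times> 2)) \<Rightarrow> ('n, 'm) tangent"
  where "of_coords c =
    (\<chi> k. c $ Inl k, \<chi> k. c $ Inr (Inl k), \<chi> p. c $ Inr (Inr (Inl p)),
     \<chi> p. c $ Inr (Inr (Inr (Inl p))), \<chi> q. c $ Inr (Inr (Inr (Inr q))))"

lemma of_coords_coords [simp]: "of_coords (coords h) = h"
  by (cases h) (simp add: of_coords_def vec_eq_iff)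

lemma coords_of_coords [simp]: "coords (of_coords c) = c"
  by (simp add: of_coords_def vec_eq_iff split: sum.split)

text \<open>The map \<open>h \<mapsto> z + cover h\<close> is the chart at \<open>z\<close> given by shifting the angles and the other
  components of \<open>z\<close>.\<close>

definition state_jacobian ::
  "params \<Rightarrow> real^'m^'n \<Rightarrow> real^'n \<Rightarrow> ('n::finite, 'm::finite) state \<Rightarrow>
   real^('n + 'n + ('n \<times> 2) + ('n \<times> 2) + ('m \<times> 2))^('n + 'n + ('n \<times> 2) + ('n \<times> 2) + ('m \<times> 2))"
  where "state_jacobian P \<B> u z =
    jacobian (coords \<circ> (\<lambda>h. vf P \<B> u (z + cover h)) \<circ> of_coords) (at 0)"

fun sync_set :: "('n::finite, 'm::finite) state \<Rightarrow> ('n, 'm) state set"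
  where "sync_set (\<gamma>, w, i, v, l) =
    {(\<gamma> + (\<chi> k. \<theta>), 0, RR \<theta> *v i, RR \<theta> *v v, RR \<theta> *v l) | \<theta>. True}"


section \<open>Set stability\<close>

text \<open>Here \<open>sol\<close> singles out the solutions of an autonomous system. By uniqueness of
  solutions, quantifying over all solutions with a given initial value is the same as referring
  to the solution with that initial value.\<close>

definition set_stable :: "((real \<Rightarrow> 'a::metric_space) \<Rightarrow> bool) \<Rightarrow> 'a set \<Rightarrow> bool"
  where "set_stable sol K \<longleftrightarrow>
    (\<forall>\<epsilon>>0. \<exists>\<delta>>0. \<forall>z. sol z \<and> infdist (z 0) K \<le> \<delta> \<longrightarrow> (\<forall>t\<ge>0. infdist (z t) K < \<epsilon>))"

definition set_asymptotically_stable :: "((real \<Rightarrow> 'a::metric_space) \<Rightarrow> bool) \<Rightarrow> 'a set \<Rightarrow> bool"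
  where "set_asymptotically_stable sol K \<longleftrightarrow> set_stable sol K \<and>
    (\<exists>N. open N \<and> K \<subseteq> N \<and>
      (\<forall>z. sol z \<and> z 0 \<in> N \<longrightarrow> ((\<lambda>t. infdist (z t) K) \<longlongrightarrow> 0) at_top))"

end

(* The vector field is equivariant under simultaneous rotation of all angles and all AC
   quantities, so everything can be transported to a chart at zs, where zs becomes the origin and
   the synchronous set becomes a curve of zeros of a C^1 field F with regular point 0.  The
   Jacobian A at 0 has a simple eigenvalue 0, its kernel being the tangent of the curve, and is
   stable on its range.  Instead of a centre manifold, the velocity is used: g = F (c t) satisfies
   g' = DF (c t) g, near 0 one has |g| <= C |A g|, and a quadratic Lyapunov form for A on its range
   makes g decay exponentially.  Trajectories thus have finite length proportional to their
   initial distance: they stay near the origin and converge to a zero of F, and the only zeros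
   near 0 are those on the curve. *)

theory Submission
  imports Defs "HOL-Computational_Algebra.Fundamental_Theorem_Algebra"
begin

section \<open>Matrices with a simple eigenvalue zero\<close>

text \<open>Simplicity of the eigenvalue 0 enters as injectivity of \<open>A\<close> on its range,
  so that every eigenvalue of the restriction lies in the open left half-plane. The quadratic form
  built there is pulled back along \<open>A\<close>; it therefore measures only \<open>A g\<close>
  and is blind to the kernel, the direction of the curve. The bound |g| <= C |A g| closes this gap:
  F vanishes along a whole curve tangent to the kernel, so near 0 the component of F complementary
  to the range of \<open>A\<close> is small compared with F itself. Existence for all times is a
  separate issue, since products of trigonometric functions with unbounded states are only locally
  Lipschitz. The field is composed with the projection onto a ball and solved globally; the length
  bound then shows that the projection never acts. The synchronous set is one orbit of an isometric
  action that commutes with the dynamics, so a radius found in the single chart at \<open>zs\<close>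
  is valid along the whole set. The chart has real angles, which turns the closed orbit into a curve
  parametrized by the real line.\<close>

definition replace_column :: "'k \<Rightarrow> 'a^'n \<Rightarrow> 'a^'k^'n \<Rightarrow> 'a^'k^'n"
  where "replace_column k a A = (\<chi> i j. if j = k then a $ i else A $ i $ j)"

text \<open>Row form, to which linearity of the determinant in one row applies.\<close>

lemma replace_column_transpose:
  "replace_column k a A = transpose (\<chi> i. if i = k then a else column i A)"
  by (simp add: replace_column_def transpose_def column_def vec_eq_iff)

lemma det_replace_column_scale:
  fixes A :: "'a::comm_ring_1^'n^'n"
  shows "det (replace_column k (c *s a) A) = c * det (replace_column k a A)"
  unfolding replace_column_transpose det_transpose by (rule det_row_mul)

lemma det_replace_column_add:
  fixes A :: "'a::comm_ring_1^'n^'n"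
  shows "det (replace_column k (a + b) A) =
    det (replace_column k a A) + det (replace_column k b A)"
  unfolding replace_column_transpose det_transpose by (rule det_row_add)

lemma det_replace_column_cramer:
  fixes A :: "'a::field^'n^'n"
  shows "det (replace_column k (A *v x) A) = x $ k * det A"
  unfolding replace_column_def by (rule cramer_lemma)

lemma replace_column_mult_vec:
  fixes A :: "'a::comm_ring_1^'n^'m"
  assumes "x $ k = 0"
  shows "replace_column k a A *v x = A *v x"
  using assms by (auto simp: replace_column_def matrix_vector_mult_def vec_eq_iff intro!: sum.cong)

lemma poly_det:
  fixes M :: "'a::comm_ring_1 poly^'n^'n"
  shows "poly (det M) z = det (\<chi> i j. poly (M $ i $ j) z)"
  by (simp add: det_def poly_sum poly_prod)

lemma poly_charpoly:
  fixes A :: "real^'k^'k"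
  shows "poly (charpoly A) z = det (mat z - map_matrix complex_of_real A)"
proof -
  have "(\<chi> i j. poly ((\<chi> i j. (if i = j then [:0, 1:] else 0) -
      [:complex_of_real (A $ i $ j):]) $ i $ j) z) = mat z - map_matrix complex_of_real A"
    by (simp add: vec_eq_iff mat_def map_matrix_def)
  then show ?thesis
    unfolding charpoly_def poly_det by simp
qed

lemma mat_mult_vec: "mat z *v v = z *s (v::'a::comm_ring_1^'k)"
  by (simp add: mat_def matrix_vector_mult_def vec_eq_iff if_distrib [of "\<lambda>f. f _"] if_distrib cong: if_cong)

text \<open>A number exceeding a bound on the operator norm cannot be an eigenvalue, so the
  polynomial does not vanish there. Nonvanishing is what makes \<open>order\<close>
  meaningful.\<close>

lemma charpoly_nonzero: "charpoly (A::real^'k^'k) \<noteq> 0"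
proof
  assume "charpoly A = 0"
  then have det0: "det (mat z - map_matrix complex_of_real A) = 0" for z
    by (metis poly_0 poly_charpoly)
  let ?T = "\<lambda>v. map_matrix complex_of_real A *v v"
  obtain B where B: "B > 0" "\<And>v. norm (?T v) \<le> B * norm v"
    using linear_bounded_pos[OF bounded_linear.linear[OF matrix_vector_mul_bounded_linear]] by blast
  let ?M = "mat (complex_of_real (B + 1)) - map_matrix complex_of_real A"
  have "\<not> invertible ?M"
    using det0 by (simp add: invertible_det_nz)
  then obtain v where v: "v \<noteq> 0" "?M *v v = 0"
    using matrix_left_invertible_ker invertible_left_inverse by blast
  then have "?T v = (B + 1) *\<^sub>R v"
    by (simp add: matrix_vector_mult_diff_rdistrib mat_mult_vec vec_eq_iff)
      (simp add: scaleR_conv_of_real algebra_simps)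
  then have "(B + 1) * norm v \<le> B * norm v"
    using B(1) B(2)[of v] by simp
  then show False
    using v(1) by (simp add: algebra_simps)
qed

text \<open>If the generalized eigenspace at \<open>0\<close> contains \<open>u\<close> and a further vector \<open>v\<close>, then replacing
  two columns of \<open>z I - A\<close> by \<open>u\<close> and \<open>v\<close> exhibits a factor \<open>z\<^sup>2\<close> of the characteristic polynomial.\<close>

lemma alg_mult_zero_span:
  fixes A :: "real^'k^'k" and u v :: "complex^'k"
  assumes simple: "alg_mult A 0 = 1"
    and u: "u \<noteq> 0" "map_matrix complex_of_real A *v u = 0"
    and v: "map_matrix complex_of_real A *v v = c *s u"
  shows "\<exists>a. v = a *s u"
proof (rule ccontr)
  assume neg: "\<nexists>a. v = a *s u"
  let ?A = "map_matrix complex_of_real A"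
  obtain i where i: "u $ i \<noteq> 0"
    using u(1) by (auto simp: vec_eq_iff)
  \<comment> \<open>Removing a multiple of \<open>u\<close> makes entry \<open>i\<close> vanish, so
    replacing column \<open>i\<close> later does not change the product with \<open>v'\<close>.
    Since \<open>u\<close> is in the kernel, the image of \<open>v\<close> is unchanged.\<close>
  define v' where "v' = v - (v $ i / u $ i) *s u"
  have v'i: "v' $ i = 0"
    using i by (simp add: v'_def)
  have "v' \<noteq> 0"
    using neg unfolding v'_def by auto
  then obtain j where j: "v' $ j \<noteq> 0"
    by (auto simp: vec_eq_iff)
  have ij: "i \<noteq> j"
    using v'i j by auto
  have Av': "?A *v v' = c *s u"
    using u v unfolding v'_def
    by (simp add: matrix_vector_mult_diff_distrib vector_scalar_commute)
  define X :: "complex poly^'k^'k" where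
    "X = replace_column j (\<chi> r. [:v' $ r:]) (replace_column i (\<chi> r. [:u $ r:])
      (\<chi> r s. (if r = s then [:0, 1:] else 0) - [:complex_of_real (A $ r $ s):]))"
  have key: "z\<^sup>2 * poly (det X) z = v' $ j * u $ i * poly (charpoly A) z" for z
  proof -
    define D0 where "D0 = mat z - ?A"
    define D1 where "D1 = replace_column i u D0"
    have D0u: "D0 *v u = z *s u"
      using u by (simp add: D0_def matrix_vector_mult_diff_rdistrib mat_mult_vec)
    have D0v: "D0 *v v' = z *s v' + (- c) *s u"
      using Av' by (simp add: D0_def matrix_vector_mult_diff_rdistrib mat_mult_vec)
    have 1: "z * det D1 = u $ i * det D0"
      using det_replace_column_cramer[of i D0 u] unfolding D0u det_replace_column_scale D1_def .
    have "column i (replace_column j u D1) = column j (replace_column j u D1)"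
      using ij by (simp add: D1_def replace_column_def column_def)
    \<comment> \<open>In Cramer's rule for \<open>D1 *v v'\<close> this kills the contribution of
      \<open>- c *s u\<close>: column \<open>i\<close> of \<open>D1\<close> is already
      \<open>u\<close>.\<close>
    then have 0: "det (replace_column j u D1) = 0"
      by (rule det_identical_columns[OF ij])
    have "D1 *v v' = z *s v' + (- c) *s u"
      unfolding D1_def using replace_column_mult_vec[OF v'i, of u D0] D0v by simp
    then have 2: "z * det (replace_column j v' D1) = v' $ j * det D1"
      using det_replace_column_cramer[of j D1 v']
      by (simp only: det_replace_column_add det_replace_column_scale 0) simp
    have "poly (det X) z = det (replace_column j v' D1)"
      unfolding poly_det
      by (rule arg_cong[of _ _ det])
        (simp add: X_def D1_def D0_def replace_column_def vec_eq_iff mat_def map_matrix_def)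
    then have "z\<^sup>2 * poly (det X) z = z * (z * det (replace_column j v' D1))"
      by (simp add: power2_eq_square)
    also have "\<dots> = v' $ j * (z * det D1)"
      by (simp add: 2)
    also have "\<dots> = v' $ j * u $ i * poly (charpoly A) z"
      by (simp add: 1 poly_charpoly D0_def)
    finally show ?thesis .
  qed
  have "poly ([:0, 1:]^2 * det X) = poly (smult (v' $ j * u $ i) (charpoly A))"
    by (rule ext) (simp add: power2_eq_square mult.assoc key[unfolded power2_eq_square mult.assoc])
  then have eq: "[:0, 1:]^2 * det X = smult (v' $ j * u $ i) (charpoly A)"
    by (simp only: poly_eq_poly_eq_iff)
  have "[:- 0, 1:]^2 dvd charpoly A"
    using eq i j by (metis dvd_smult_cancel dvd_triv_left minus_zero mult_eq_0_iff)
  moreover have "charpoly A \<noteq> 0"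
    by (rule charpoly_nonzero)
  ultimately have "2 \<le> order 0 (charpoly A)"
    using order_divides by blast
  then show False
    using simple by (simp add: alg_mult_def)
qed

section \<open>Polynomials in a matrix, p(A) x evaluated by Horner's rule, and Lyapunov
  forms\<close>

definition poly_mat_vec :: "'a::field^'n^'n \<Rightarrow> 'a poly \<Rightarrow> 'a^'n \<Rightarrow> 'a^'n"
  where "poly_mat_vec A p x = fold_coeffs (\<lambda>a y. a *s x + A *v y) p 0"

lemma poly_mat_vec_0 [simp]: "poly_mat_vec A 0 x = 0"
  by (simp add: poly_mat_vec_def)

lemma poly_mat_vec_pCons [simp]:
  "poly_mat_vec A (pCons a p) x = a *s x + A *v poly_mat_vec A p x"
  by (cases "p = 0 \<and> a = 0") (auto simp: poly_mat_vec_def)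

lemma poly_mat_vec_add:
  "poly_mat_vec A (p + q) x = poly_mat_vec A p x + poly_mat_vec A q x"
  by (induction p q rule: poly_induct2)
    (simp_all add: vector_sadd_rdistrib matrix_vector_right_distrib)

lemma poly_mat_vec_smult: "poly_mat_vec A (smult c p) x = c *s poly_mat_vec A p x"
  by (induction p)
    (simp_all add: vector_ssub_ldistrib vector_add_ldistrib vector_scalar_commute)

lemma poly_mat_vec_diff:
  "poly_mat_vec A (p - q) x = poly_mat_vec A p x - poly_mat_vec A q x"
  using poly_mat_vec_add[of A "p - q" q x] by simp

lemma poly_mat_vec_sum: "poly_mat_vec A (\<Sum>k\<in>S. p k) x = (\<Sum>k\<in>S. poly_mat_vec A (p k) x)"
  by (induction S rule: infinite_finite_induct) (simp_all add: poly_mat_vec_add)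

lemma poly_mat_vec_diff_arg:
  "poly_mat_vec A p (x - y) = poly_mat_vec A p x - poly_mat_vec A p y"
  by (induction p)
    (simp_all add: vector_ssub_ldistrib matrix_vector_mult_diff_distrib)

lemma poly_mat_vec_scale_arg: "poly_mat_vec A p (c *s x) = c *s poly_mat_vec A p x"
  by (induction p) (simp_all add: vector_add_ldistrib vector_scalar_commute mult.commute)

lemma poly_mat_vec_apply_arg: "poly_mat_vec A p (A *v x) = A *v poly_mat_vec A p x"
  by (induction p) (simp_all add: matrix_vector_right_distrib vector_scalar_commute)

text \<open>Used to peel off a root: where the left side vanishes, q(A) x is zero or an eigenvector
  for \<open>l\<close>.\<close>

lemma poly_mat_vec_linear_factor:
  "poly_mat_vec A ([:- l, 1:] * q) x = A *v poly_mat_vec A q x - l *s poly_mat_vec A q x"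
  by (simp add: poly_mat_vec_diff poly_mat_vec_smult)

lemma poly_mat_vec_in:
  assumes "vec.subspace W" "\<And>x. x \<in> W \<Longrightarrow> A *v x \<in> W" "x \<in> W"
  shows "poly_mat_vec A p (x::'a::field^'n) \<in> W"
  using assms by (induction p) (auto simp: vec.subspace_0 vec.subspace_add vec.subspace_scale)

text \<open>\<open>dependent\<close> speaks of sets, while a sequence may repeat a vector; a
  repetition \<open>f i = f j\<close> gives the relation f i - f j = 0 directly.\<close>

lemma linearly_dependent_sequence:
  fixes f :: "nat \<Rightarrow> 'a::euclidean_space"
  obtains a k where "k \<le> DIM('a)" "a k \<noteq> 0" "(\<Sum>k\<le>DIM('a). a k *\<^sub>R f k) = 0"
proof (cases "inj_on f {..DIM('a)}")
  case True
  then have "card (f ` {..DIM('a)}) = DIM('a) + 1"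
    by (simp add: card_image)
  then have "dependent (f ` {..DIM('a)})"
    by (intro dependent_biggerset) simp
  then obtain c v where c: "v \<in> f ` {..DIM('a)}" "c v \<noteq> 0" "(\<Sum>v\<in>f ` {..DIM('a)}. c v *\<^sub>R v) = 0"
    by (auto simp: dependent_finite)
  then show ?thesis
    using that[of _ "c \<circ> f"] by (auto simp: sum.reindex[OF True])
next
  case False
  then obtain i j where ij: "i \<le> DIM('a)" "j \<le> DIM('a)" "i \<noteq> j" "f i = f j"
    by (auto simp: inj_on_def)
  let ?a = "\<lambda>k. (if k = i then 1 else 0) - (if k = j then 1 else 0::real)"
  have "(\<Sum>k\<le>DIM('a). ?a k *\<^sub>R f k) = 0"
    using ij by (simp add: scaleR_left_diff_distrib sum_subtractf if_distrib[of "\<lambda>c. c *\<^sub>R _"] cong: if_cong)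
  then show ?thesis
    using that[of i ?a] ij by simp
qed

lemma sum_matrix_vector_mult: "(\<Sum>k\<in>S. M k) *v x = (\<Sum>k\<in>S. M k *v x)"
  by (induction S rule: infinite_finite_induct) (simp_all add: matrix_vector_mult_add_rdistrib)

text \<open>The powers of \<open>A\<close> lie in a finite-dimensional real space of matrices, so
  enough of them are linearly dependent; the real coefficients of the relation, read as complex
  numbers, form \<open>p\<close>.\<close>

lemma annihilating_polynomial:
  fixes A :: "complex^'n^'n"
  obtains p where "p \<noteq> 0" "\<And>x. poly_mat_vec A p x = 0"
proof -
  define m where "m k = (((**) A) ^^ k) (mat 1)" for k
  obtain a j where a: "j \<le> DIM(complex^'n^'n)" "a j \<noteq> 0"
    "(\<Sum>k\<le>DIM(complex^'n^'n). a k *\<^sub>R m k) = 0"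
    by (rule linearly_dependent_sequence)
  let ?d = "DIM(complex^'n^'n)"
  define p where "p = (\<Sum>k\<le>?d. monom (complex_of_real (a k)) k)"
  have mono: "poly_mat_vec A (monom c k) x = c *s (m k *v x)" for c k x
    by (induction k) (simp_all add: m_def monom_0 monom_Suc matrix_vector_mul_assoc[symmetric]
      vector_scalar_commute)
  have "coeff p j = complex_of_real (a j)"
    using a(1) by (simp add: p_def coeff_sum if_distrib cong: if_cong)
  then have "p \<noteq> 0"
    using a(2) by auto
  moreover have "poly_mat_vec A p x = 0" for x
  proof -
    have "poly_mat_vec A p x = (\<Sum>k\<le>?d. complex_of_real (a k) *s (m k *v x))"
      by (simp add: p_def poly_mat_vec_sum mono)
    also have "\<dots> = (\<Sum>k\<le>?d. (a k *\<^sub>R m k) *v x)"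
      by (intro sum.cong refl)
        (simp add: vec_eq_iff matrix_vector_mult_def sum_distrib_left scaleR_conv_of_real[where 'a=complex] mult.assoc)
    also have "\<dots> = (\<Sum>k\<le>?d. a k *\<^sub>R m k) *v x"
      by (simp only: sum_matrix_vector_mult)
    finally show ?thesis
      using a(3) by simp
  qed
  ultimately show ?thesis
    by (rule that)
qed

text \<open>The inner product on complex vectors is the real one, the real part of the Hermitian
  product. Hence only \<open>Re l\<close> matters in the Lyapunov estimate.\<close>

lemma inner_scale_complex: "x \<bullet> (l *s x) = Re l * (norm x)\<^sup>2" for x :: "complex^'n"
proof -
  have "x $ k \<bullet> (l * x $ k) = Re l * (x $ k \<bullet> x $ k)" for k
    by (simp add: inner_complex_def algebra_simps)
  then show ?thesis
    by (simp add: power2_norm_eq_inner inner_vec_def sum_distrib_left)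
qed

text \<open>Induction on the annihilating polynomial: for a root \<open>l\<close> in the open left half-plane and
  \<open>S = A - l I\<close>, take \<open>x \<bullet> y + c B (S x) (S y)\<close> with \<open>B\<close> the form for the invariant
  subspace \<open>S W\<close> and \<open>c\<close> large enough to absorb \<open>x \<bullet> S x\<close>.\<close>

lemma lyapunov_form:
  fixes A :: "complex^'n^'n"
  assumes "p \<noteq> 0" "vec.subspace W" "\<And>x. x \<in> W \<Longrightarrow> A *v x \<in> W"
    and "\<And>x. x \<in> W \<Longrightarrow> poly_mat_vec A p x = 0"
    and "\<And>l x. x \<in> W \<Longrightarrow> A *v x = l *s x \<Longrightarrow> x \<noteq> 0 \<Longrightarrow> Re l < 0"
  shows "\<exists>B a. bounded_bilinear B \<and> (\<forall>x y. B x y = B y x) \<and> a > (0::real) \<and>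
    (\<forall>x\<in>W. (norm x)\<^sup>2 \<le> B x x \<and> B x (A *v x) \<le> - a * (norm x)\<^sup>2)"
  using assms
proof (induction "degree p" arbitrary: p W)
  case 0
  then obtain c where c: "p = [:c:]" "c \<noteq> 0"
    by (metis degree_eq_zeroE pCons_0_0)
  then have "x = 0" if "x \<in> W" for x
    using "0.prems"(4)[OF that] by (simp add: vec_eq_iff)
  then have "W \<subseteq> {0}"
    by blast
  then have "bounded_bilinear (\<lambda>x y::complex^'n. x \<bullet> y) \<and> (\<forall>x y::complex^'n. x \<bullet> y = y \<bullet> x) \<and> (1::real) > 0 \<and>
    (\<forall>x\<in>W. (norm x)\<^sup>2 \<le> x \<bullet> x \<and> x \<bullet> (A *v x) \<le> - 1 * (norm x)\<^sup>2)"
    using bounded_bilinear_inner by (auto simp: inner_commute subset_singleton_iff)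
  then show ?case
    by blast
next
  case (Suc d)
  then obtain l where "poly p l = 0"
    using alg_closed_imp_poly_has_root[of p] by auto
  then obtain q where q: "p = [:- l, 1:] * q"
    by (meson dvdE poly_eq_0_iff_dvd)
  have q0: "q \<noteq> 0"
    using q Suc.prems(1) by auto
  have dq: "d = degree q"
    using q q0 Suc.hyps(2) degree_mult_eq[of "[:- l, 1:]" q] by simp
  define S where "S x = A *v x - l *s x" for x
  note W = Suc.prems(2)
  have qS: "poly_mat_vec A q (S x) = poly_mat_vec A p x" for x
    by (simp add: q poly_mat_vec_linear_factor S_def poly_mat_vec_diff_arg poly_mat_vec_scale_arg
      poly_mat_vec_apply_arg del: mult_pCons_left)
  show ?case
  proof (cases "Re l < 0")
    case False
    have zero: "poly_mat_vec A q x = 0" if "x \<in> W" for x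
    proof (rule ccontr)
      assume "poly_mat_vec A q x \<noteq> 0"
      moreover have "A *v poly_mat_vec A q x = l *s poly_mat_vec A q x"
        using Suc.prems(4)[OF that] unfolding q poly_mat_vec_linear_factor by simp
      ultimately show False
        using Suc.prems(5) poly_mat_vec_in[OF W Suc.prems(3) that] False by blast
    qed
    show ?thesis
      by (rule Suc.hyps(1)[OF dq q0 W], erule Suc.prems(3), erule zero, rule Suc.prems(5))
  next
    case True
    have SW: "S ` W \<subseteq> W"
      unfolding S_def using W Suc.prems(3) by (auto intro: vec.subspace_diff vec.subspace_scale)
    have S_lin: "Vector_Spaces.linear (*s) (*s) S"
      unfolding S_def
      by unfold_locales (simp_all add: vector_add_ldistrib matrix_vector_right_distrib
        vector_scalar_commute vector_ssub_ldistrib)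
    have SA: "S (A *v x) = A *v S x" for x
      by (simp add: S_def matrix_vector_mult_diff_distrib vector_scalar_commute)
    have sub: "vec.subspace (S ` W)"
      using vec.linear_subspace_image[OF S_lin W] .
    have inv: "A *v y \<in> S ` W" if "y \<in> S ` W" for y
      using that SA Suc.prems(3) by (metis (no_types, lifting) image_iff)
    have zero: "poly_mat_vec A q y = 0" if "y \<in> S ` W" for y
      using that qS Suc.prems(4) by auto
    have "\<exists>B a. bounded_bilinear B \<and> (\<forall>x y. B x y = B y x) \<and> a > (0::real) \<and>
        (\<forall>x\<in>S ` W. (norm x)\<^sup>2 \<le> B x x \<and> B x (A *v x) \<le> - a * (norm x)\<^sup>2)"
      by (rule Suc.hyps(1)[OF dq q0 sub], erule inv, erule zero, rule Suc.prems(5), erule subsetD[OF SW])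
    then obtain B a where B: "bounded_bilinear B" "\<And>x y. B x y = B y x" "a > 0"
      "\<And>y. y \<in> S ` W \<Longrightarrow> (norm y)\<^sup>2 \<le> B y y"
      "\<And>y. y \<in> S ` W \<Longrightarrow> B y (A *v y) \<le> - a * (norm y)\<^sup>2"
      by blast
    \<comment> \<open>The root contributes -2 b |x|^2. Half of it pays for the cross term, x . S x
      <= b |x|^2 + |S x|^2 / (4 b); the constant \<open>c\<close> below satisfies c a = 1 / (4 b),
      so the decay of the second summand cancels the rest.\<close>
    define b where "b = - Re l / 2"
    have b: "b > 0" "Re l = - 2 * b"
      using True by (simp_all add: b_def)
    define c where "c = 1 / (4 * a * b)"
    have c: "c > 0"
      using b B(3) by (simp add: c_def)
    define B' where "B' x y = x \<bullet> y + c *\<^sub>R B (S x) (S y)" for x y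
    have "linear S"
      unfolding S_def
      by (intro linear_compose_sub bounded_linear.linear[OF matrix_vector_mul_bounded_linear])
        (auto intro!: linearI simp: vec_eq_iff algebra_simps)
    moreover have "linear (B x)" "linear (\<lambda>x. B x y)" for x y
      using B(1) by (simp_all add: bilinear_conv_bounded_bilinear[symmetric] bilinear_def)
    moreover have "linear (\<lambda>x. h (S x))" if "linear h" for h :: "complex^'n \<Rightarrow> real"
      using linear_compose[OF \<open>linear S\<close> that] by (simp add: o_def)
    ultimately have "linear (\<lambda>y. B (S x) (S y))" "linear (\<lambda>x. B (S x) (S y))" for x y
      by blast+
    then have "bilinear B'"
      unfolding bilinear_def B'_def
      by (intro conjI allI linear_compose_add linear_compose_scale_right bounded_linear.linear[OF bounded_linear_inner_right]
        bounded_linear.linear[OF bounded_linear_inner_left])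
    then have "bounded_bilinear B'"
      by (simp add: bilinear_conv_bounded_bilinear)
    moreover have "B' x y = B' y x" for x y
      by (simp add: B'_def inner_commute B(2))
    moreover have "(norm x)\<^sup>2 \<le> B' x x" if "x \<in> W" for x
    proof -
      have "0 \<le> (norm (S x))\<^sup>2"
        by simp
      also have "\<dots> \<le> B (S x) (S x)"
        using B(4) that by blast
      finally show ?thesis
        using c by (simp add: B'_def power2_norm_eq_inner)
    qed
    moreover have "B' x (A *v x) \<le> - b * (norm x)\<^sup>2" if "x \<in> W" for x
    proof -
      have Ax: "A *v x = l *s x + S x"
        by (simp add: S_def)
      have "x \<bullet> (A *v x) = - 2 * b * (norm x)\<^sup>2 + x \<bullet> S x"
        unfolding Ax by (simp add: inner_add_right inner_scale_complex b(2))
      moreover have "c * B (S x) (S (A *v x)) \<le> c * (- a * (norm (S x))\<^sup>2)"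
        unfolding SA using B(5)[of "S x"] that c by (intro mult_left_mono) auto
      moreover have "c * (- a * (norm (S x))\<^sup>2) = - ((norm (S x))\<^sup>2 / (4 * b))"
        using B(3) by (simp add: c_def)
      moreover have "x \<bullet> S x \<le> norm x * norm (S x)"
        by (rule norm_cauchy_schwarz)
      moreover have "norm x * norm (S x) \<le> b * (norm x)\<^sup>2 + (norm (S x))\<^sup>2 / (4 * b)"
      proof -
        have "0 \<le> (2 * b * norm x - norm (S x))\<^sup>2 / (4 * b)"
          using b by simp
        also have "\<dots> = b * (norm x)\<^sup>2 + (norm (S x))\<^sup>2 / (4 * b) - norm x * norm (S x)"
          using b by (simp add: field_simps power2_eq_square)
        finally show ?thesis
          by simp
      qed
      ultimately show ?thesis
        by (simp add: B'_def)
    qed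
    ultimately show ?thesis
      using b(1) by blast
  qed
qed

text \<open>There is no Jordan chain at 0: if \<open>A *v x\<close> were a nonzero kernel vector,
  then \<open>x\<close> would be a multiple of it and so be killed by \<open>A\<close>.\<close>

lemma simple_zero_injective_on_range:
  fixes A :: "real^'k^'k" and x :: "complex^'k"
  assumes "alg_mult A 0 = 1"
    and "map_matrix complex_of_real A *v (map_matrix complex_of_real A *v x) = 0"
  shows "map_matrix complex_of_real A *v x = 0"
proof (rule ccontr)
  let ?u = "map_matrix complex_of_real A *v x"
  assume "?u \<noteq> 0"
  then obtain a where "x = a *s ?u"
    using alg_mult_zero_span[OF assms(1), of ?u x 1] assms(2) by auto
  then have "?u = a *s (map_matrix complex_of_real A *v ?u)"
    by (metis vector_scalar_commute)
  then show False
    using \<open>?u \<noteq> 0\<close> assms(2) by simp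
qed

section \<open>Transfer from complex to real vectors\<close>

definition complex_vec :: "real^'n \<Rightarrow> complex^'n"
  where "complex_vec x = (\<chi> k. complex_of_real (x $ k))"

lemma norm_complex_vec [simp]: "norm (complex_vec x) = norm x"
  by (simp add: complex_vec_def norm_vec_def)

lemma complex_vec_eq_0_iff [simp]: "complex_vec x = 0 \<longleftrightarrow> x = 0"
  by (metis norm_complex_vec norm_eq_zero)

lemma linear_complex_vec: "linear complex_vec"
  by (rule linearI) (simp_all add: complex_vec_def vec_eq_iff, simp add: scaleR_conv_of_real)

lemma complex_vec_mult:
  "complex_vec (A *v x) = map_matrix complex_of_real A *v complex_vec x"
  by (simp add: complex_vec_def matrix_vector_mult_def map_matrix_def vec_eq_iff)

text \<open>The span argument yields a complex factor; as \<open>k\<close> and \<open>x\<close> are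
  real, its real part serves as well.\<close>

lemma simple_zero_kernel:
  fixes A :: "real^'k^'k"
  assumes "alg_mult A 0 = 1" "k \<noteq> 0" "A *v k = 0" "A *v x = 0"
  obtains a where "x = a *\<^sub>R k"
proof -
  have "complex_vec k \<noteq> 0" "map_matrix complex_of_real A *v complex_vec k = 0"
    "map_matrix complex_of_real A *v complex_vec x = 0 *s complex_vec k"
    using assms(2-4) by (simp_all add: complex_vec_mult[symmetric])
  then obtain c where "complex_vec x = c *s complex_vec k"
    using alg_mult_zero_span[OF assms(1)] by blast
  then have c: "complex_of_real (x $ s) = c * complex_of_real (k $ s)" for s
    by (simp add: complex_vec_def vec_eq_iff)
  have "x = Re c *\<^sub>R k"
    using arg_cong[OF c, of Re] by (simp add: vec_eq_iff)
  then show ?thesis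
    by (rule that)
qed

lemma simple_zero_square_kernel:
  fixes A :: "real^'k^'k"
  assumes "alg_mult A 0 = 1" "A *v (A *v x) = 0"
  shows "A *v x = 0"
proof -
  have "map_matrix complex_of_real A *v complex_vec x = 0"
    by (rule simple_zero_injective_on_range[OF assms(1)])
      (use assms(2) in \<open>simp flip: complex_vec_mult\<close>)
  then show ?thesis
    by (simp flip: complex_vec_mult)
qed

text \<open>The form comes from the complex range of \<open>A\<close> and is pulled back along
  \<open>A\<close>, so it degenerates on the kernel. That is why all bounds are in terms of
  \<open>norm (A *v x)\<close>.\<close>

lemma simple_zero_lyapunov_form:
  fixes A :: "real^'k^'k"
  assumes simple: "alg_mult A 0 = 1"
    and stable: "\<And>c. eigenvalue A c \<Longrightarrow> c \<noteq> 0 \<Longrightarrow> Re c < 0"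
  obtains B a K where "bounded_bilinear B" "\<And>x y. B x y = B y x" "a > (0::real)" "K > 0"
    "\<And>x. (norm (A *v x))\<^sup>2 \<le> B x x" "\<And>x. B x (A *v x) \<le> - a * (norm (A *v x))\<^sup>2"
    "\<And>x y. \<bar>B x y\<bar> \<le> K * norm (A *v x) * norm (A *v y)"
proof -
  let ?A = "map_matrix complex_of_real A"
  define W where "W = range ((*v) ?A)"
  have W: "vec.subspace W"
    unfolding W_def using vec.linear_subspace_image[OF matrix_vector_mul_linear_gen vec.subspace_UNIV] .
  have invariant: "?A *v x \<in> W" if "x \<in> W" for x
    by (simp add: W_def)
  have stableW: "Re l < 0" if "x \<in> W" "?A *v x = l *s x" "x \<noteq> 0" for l x
  proof -
    have "eigenvalue A l"
      using that by (auto simp: eigenvalue_def)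
    moreover have "l \<noteq> 0"
      using that simple_zero_injective_on_range[OF simple] by (auto simp: W_def)
    ultimately show ?thesis
      using stable by blast
  qed
  obtain p where p: "p \<noteq> 0" "\<And>x. poly_mat_vec ?A p x = 0"
    using annihilating_polynomial by blast
  have "\<exists>B a. bounded_bilinear B \<and> (\<forall>x y. B x y = B y x) \<and> a > (0::real) \<and>
      (\<forall>x\<in>W. (norm x)\<^sup>2 \<le> B x x \<and> B x (?A *v x) \<le> - a * (norm x)\<^sup>2)"
    by (rule lyapunov_form[OF p(1) W], erule invariant, rule p(2), rule stableW)
  then obtain B a where B: "bounded_bilinear B" "\<And>x y. B x y = B y x" "a > (0::real)"
    "\<And>x. x \<in> W \<Longrightarrow> (norm x)\<^sup>2 \<le> B x x" "\<And>x. x \<in> W \<Longrightarrow> B x (?A *v x) \<le> - a * (norm x)\<^sup>2"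
    by blast
  define B' where "B' x y = B (complex_vec (A *v x)) (complex_vec (A *v y))" for x y
  have lin: "bounded_linear (\<lambda>x. complex_vec (A *v x))"
    using linear_compose[OF matrix_vector_mul_linear[of A] linear_complex_vec]
    by (simp add: linear_conv_bounded_linear o_def)
  obtain K where K: "K > 0" "\<And>x y. norm (B x y) \<le> norm x * norm y * K"
    using bounded_bilinear.pos_bounded[OF B(1)] by blast
  have in_W: "complex_vec (A *v x) \<in> W" for x
    by (simp add: W_def complex_vec_mult)
  show ?thesis
  proof (rule that[of B' a K, OF _ _ B(3) K(1)])
    show "bounded_bilinear B'"
      unfolding B'_def by (rule bounded_bilinear.comp[OF B(1) lin lin])
    show "B' x y = B' y x" for x y
      by (simp add: B'_def B(2))
    show "(norm (A *v x))\<^sup>2 \<le> B' x x" for x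
      using B(4)[OF in_W[of x]] by (simp add: B'_def flip: complex_vec_mult)
    show "B' x (A *v x) \<le> - a * (norm (A *v x))\<^sup>2" for x
      using B(5)[OF in_W[of x]] by (simp add: B'_def flip: complex_vec_mult)
    show "\<bar>B' x y\<bar> \<le> K * norm (A *v x) * norm (A *v y)" for x y
      using K(2)[of "complex_vec (A *v x)" "complex_vec (A *v y)"] by (simp add: B'_def mult_ac)
  qed
qed

section \<open>Global solutions of Lipschitz differential equations\<close>

lemma has_vector_derivative_integral_atLeast:
  fixes g :: "real \<Rightarrow> 'a::banach"
  assumes "continuous_on UNIV g" "0 \<le> t"
  shows "((\<lambda>t. integral {0..t} g) has_vector_derivative g t) (at t within {0..})"
proof -
  have "((\<lambda>t. integral {0..t} g) has_vector_derivative g t) (at t within {0..t + 1})"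
    using assms by (intro integral_has_vector_derivative) (auto intro: continuous_on_subset)
  moreover have "at t within {0..t + 1} = at t within {0..}"
    by (rule at_within_nhd[of t "{..<t + 1}"]) auto
  ultimately show ?thesis
    by simp
qed

text \<open>Integration against the exponential weight gains the factor 1 / \<beta>, the source of
  the contraction below.\<close>

lemma norm_integral_le_exp:
  fixes g :: "real \<Rightarrow> 'a::banach"
  assumes "continuous_on UNIV g" "0 \<le> t" "\<beta> > 0" "K \<ge> 0"
    and "\<And>s. 0 \<le> s \<Longrightarrow> norm (g s) \<le> K * exp (\<beta> * s)"
  shows "norm (integral {0..t} g) \<le> K / \<beta> * exp (\<beta> * t)"
proof -
  have I: "((\<lambda>s. K * exp (\<beta> * s)) has_integral (K / \<beta> * exp (\<beta> * t) - K / \<beta> * exp (\<beta> * 0))) {0..t}"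
    using assms(2,3)
    by (intro fundamental_theorem_of_calculus)
      (auto intro!: derivative_eq_intros simp flip: has_real_derivative_iff_has_vector_derivative)
  have "norm (integral {0..t} g) \<le> integral {0..t} (\<lambda>s. K * exp (\<beta> * s))"
    using I assms(1,5)
    by (intro integral_norm_bound_integral integrable_continuous_real)
      (auto intro: continuous_on_subset intro!: continuous_intros)
  also have "\<dots> \<le> K / \<beta> * exp (\<beta> * t)"
    using integral_unique[OF I] assms(3,4) by simp
  finally show ?thesis .
qed

text \<open>Picard iteration contracts in the norm \<open>sup\<^sub>t e\<^bsup>-(L+1)t\<^esup> \<parallel>x(t)\<parallel>\<close>, which gives the solution on
  all of \<open>[0, \<infinity>)\<close> at once; \<open>u\<close> below is the rescaled solution.\<close>

theorem picard_global:
  fixes f :: "'a::banach \<Rightarrow> 'a"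
  assumes lip: "\<And>x y. norm (f x - f y) \<le> L * norm (x - y)" and L: "L \<ge> 0"
  obtains x where "x 0 = x0" "\<And>t. t \<ge> 0 \<Longrightarrow> (x has_vector_derivative f (x t)) (at t within {0..})"
proof -
  \<comment> \<open>The contraction factor is L / \<beta>, so any weight larger than
    \<open>L\<close> works; adding 1 also covers L = 0.\<close>
  define \<beta> where "\<beta> = L + 1"
  have \<beta>: "\<beta> > 0" "L / \<beta> < 1"
    using L by (simp_all add: \<beta>_def)
  have cont_f: "continuous_on UNIV f"
    by (rule lipschitz_on_continuous_on[of L], rule lipschitz_onI) (use lip L in \<open>auto simp: dist_norm\<close>)
  define g where "g u s = f (exp (\<beta> * s) *\<^sub>R apply_bcontfun u s)" for u s
  have cont_g: "continuous_on UNIV (g u)" for u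
    unfolding g_def by (intro continuous_on_compose2[OF cont_f] continuous_intros) auto
  define I where "I u t = x0 + integral {0..t} (g u)" for u t
  have I_deriv: "(I u has_vector_derivative g u t) (at t within {0..})" if "t \<ge> 0" for u t
    unfolding I_def
    using has_vector_derivative_add[OF has_vector_derivative_const has_vector_derivative_integral_atLeast[OF cont_g that]]
    by simp
  then have cont_I: "continuous_on {0..} (I u)" for u
    by (auto simp: continuous_on_eq_continuous_within intro!: has_vector_derivative_continuous)
  \<comment> \<open>Bounded continuous functions live on the whole line, so the rescaled integral is
    frozen at its value at 0 for negative times.\<close>
  define \<Phi> where "\<Phi> u t = exp (- \<beta> * max 0 t) *\<^sub>R I u (max 0 t)" for u t
  have scaled: "norm (exp (- \<beta> * t) *\<^sub>R y) \<le> K" if "norm y \<le> K * exp (\<beta> * t)" for y :: 'a and K t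
    using that by (simp add: exp_minus field_simps)
  have "\<Phi> u \<in> bcontfun" for u
  proof (rule bcontfun_normI)
    show "continuous_on UNIV (\<Phi> u)"
      unfolding \<Phi>_def by (intro continuous_intros continuous_on_compose2[OF cont_I]) auto
    define K where "K = norm (f 0) + L * norm u"
    have K: "K \<ge> 0"
      using L by (simp add: K_def)
    have g: "norm (g u s) \<le> K * exp (\<beta> * s)" if "0 \<le> s" for s
    proof -
      have "norm (g u s) \<le> norm (f 0) + L * norm (exp (\<beta> * s) *\<^sub>R apply_bcontfun u s)"
        using lip[of "exp (\<beta> * s) *\<^sub>R apply_bcontfun u s" 0]
          norm_triangle_sub[of "g u s" "f 0"] by (simp add: g_def)
      also have "\<dots> \<le> norm (f 0) * exp (\<beta> * s) + L * (exp (\<beta> * s) * norm u)"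
        using that \<beta> L norm_bounded[of u s]
        by (intro add_mono mult_left_mono) (simp_all add: mult_le_cancel_left1)
      finally show ?thesis
        by (simp add: K_def algebra_simps)
    qed
    show "norm (\<Phi> u t) \<le> norm x0 + K / \<beta>" for t
      unfolding \<Phi>_def
    proof (rule scaled)
      have "norm (I u (max 0 t)) \<le> norm x0 + K / \<beta> * exp (\<beta> * max 0 t)"
        unfolding I_def
        by (rule norm_triangle_mono[OF order_refl norm_integral_le_exp[OF cont_g]]) (use \<beta> K g in auto)
      also have "norm x0 \<le> norm x0 * exp (\<beta> * max 0 t)"
        using \<beta> by (simp add: mult_le_cancel_left1)
      finally show "norm (I u (max 0 t)) \<le> (norm x0 + K / \<beta>) * exp (\<beta> * max 0 t)"
        by (simp add: algebra_simps)
    qed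
  qed
  then have apply_\<Phi>: "apply_bcontfun (Bcontfun (\<Phi> u)) = \<Phi> u" for u
    by (simp add: Bcontfun_inverse)
  have "dist (Bcontfun (\<Phi> u)) (Bcontfun (\<Phi> v)) \<le> L / \<beta> * dist u v" for u v
  proof (rule dist_bound)
    fix t
    define r where "r = max 0 (t::real)"
    have "g u integrable_on {0..r}" for u
      using cont_g by (auto intro: integrable_continuous_real continuous_on_subset)
    then have "I u r - I v r = integral {0..r} (\<lambda>s. g u s - g v s)"
      by (simp add: I_def integral_diff)
    also have "norm \<dots> \<le> (L * dist u v) / \<beta> * exp (\<beta> * r)"
    proof (rule norm_integral_le_exp)
      show "norm (g u s - g v s) \<le> L * dist u v * exp (\<beta> * s)" for s
      proof -
        have "norm (g u s - g v s) \<le> L * (exp (\<beta> * s) * dist (apply_bcontfun u s) (apply_bcontfun v s))"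
          using lip[of "exp (\<beta> * s) *\<^sub>R apply_bcontfun u s" "exp (\<beta> * s) *\<^sub>R apply_bcontfun v s"]
          by (simp add: g_def dist_norm flip: scaleR_diff_right)
        also have "\<dots> \<le> L * (exp (\<beta> * s) * dist u v)"
          using L by (intro mult_left_mono dist_bounded) auto
        finally show ?thesis
          by (simp add: mult_ac)
      qed
    qed (use \<beta> L cont_g in \<open>auto simp: r_def intro: continuous_intros\<close>)
    finally have "norm (exp (- \<beta> * r) *\<^sub>R (I u r - I v r)) \<le> L / \<beta> * dist u v"
      by (intro scaled) simp
    then show "dist (apply_bcontfun (Bcontfun (\<Phi> u)) t) (apply_bcontfun (Bcontfun (\<Phi> v)) t) \<le> L / \<beta> * dist u v"
      unfolding apply_\<Phi> by (simp add: \<Phi>_def dist_norm r_def scaleR_diff_right)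
  qed
  then obtain u where "Bcontfun (\<Phi> u) = u"
    using banach_fix_type[of "L / \<beta>" "\<lambda>u. Bcontfun (\<Phi> u)"] \<beta> L by auto
  then have u: "apply_bcontfun u = \<Phi> u"
    using apply_\<Phi> by metis
  have "g u t = f (I u t)" if "t \<ge> 0" for t
    using that by (simp add: g_def u \<Phi>_def exp_minus)
  then show ?thesis
    using I_deriv[of _ u] by (intro that[of "I u"]) (simp_all add: I_def)
qed

section \<open>Convergence to a curve of equilibria\<close>

text \<open>Here \<open>norm A\<close> is the Frobenius norm, and Cauchy-Schwarz is applied to each
  row.\<close>

lemma norm_matrix_vector_mult_le: "norm (A *v x) \<le> norm A * norm (x::real^'n)"
proof -
  have "norm (A *v x) \<le> L2_set (\<lambda>i. norm (A $ i) * norm x) UNIV"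
    unfolding norm_vec_def[of "A *v x"]
    by (rule L2_set_mono) (simp_all add: matrix_vector_mul_component Cauchy_Schwarz_ineq2)
  also have "\<dots> = norm A * norm x"
    by (simp add: norm_vec_def[of A] L2_set_left_distrib)
  finally show ?thesis .
qed

lemma exp_decay_tendsto_0:
  assumes "(b::real) > 0"
  shows "((\<lambda>t. exp (- b * t)) \<longlongrightarrow> 0) at_top"
  using assms
  by (intro filterlim_compose[OF exp_at_bot] filterlim_tendsto_neg_mult_at_bot[OF tendsto_const] filterlim_ident) auto

locale C1_field =
  fixes F :: "real^'n \<Rightarrow> real^'n" and M :: "real^'n \<Rightarrow> real^'n^'n"
  assumes F_deriv: "(F has_derivative (*v) (M x)) (at x)"
    and M_cont: "continuous_on UNIV M"
begin

lemma F_cont: "continuous_on S F"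
  by (rule has_derivative_continuous_on[OF has_derivative_at_withinI[OF F_deriv]])

text \<open>Mean value inequality for the field minus its linearization, whose derivative is small
  on a small ball by continuity of \<open>M\<close>. The first bound controls the perturbation in
  the equation for the velocity, the second compares points near 0.\<close>

lemma strict_derivative_at_0:
  assumes "\<epsilon> > 0"
  obtains r where "r > 0" "\<And>x. norm x \<le> r \<Longrightarrow> norm (M x - M 0) \<le> \<epsilon>"
    "\<And>x y. norm x \<le> r \<Longrightarrow> norm y \<le> r \<Longrightarrow> norm (F x - F y - M 0 *v (x - y)) \<le> \<epsilon> * norm (x - y)"
proof -
  have "isCont M 0"
    using M_cont by (simp add: continuous_on_eq_continuous_at)
  then obtain d where d: "d > 0" "\<And>x. norm x < d \<Longrightarrow> norm (M x - M 0) < \<epsilon>"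
    using assms unfolding continuous_at_eps_delta by (auto simp: dist_norm)
  define r where "r = d / 2"
  have r: "r > 0" "\<And>x. norm x \<le> r \<Longrightarrow> norm (M x - M 0) \<le> \<epsilon>"
    using d by (auto simp: r_def intro: less_imp_le)
  show ?thesis
  proof (rule that[OF r])
    fix x y :: "real^'n"
    assume xy: "norm x \<le> r" "norm y \<le> r"
    have "norm ((F x - M 0 *v x) - (F y - M 0 *v y)) \<le> \<epsilon> * norm (x - y)"
    proof (rule differentiable_bound[of "cball 0 r" _ "\<lambda>z h. M z *v h - M 0 *v h"])
      show "((\<lambda>x. F x - M 0 *v x) has_derivative (\<lambda>h. M z *v h - M 0 *v h)) (at z within cball 0 r)" for z
        by (intro has_derivative_diff has_derivative_at_withinI[OF F_deriv]
          bounded_linear_imp_has_derivative) simp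
      show "onorm (\<lambda>h. M z *v h - M 0 *v h) \<le> \<epsilon>" if "z \<in> cball 0 r" for z
      proof (rule onorm_le)
        fix h
        have "norm (M z *v h - M 0 *v h) \<le> norm (M z - M 0) * norm h"
          using norm_matrix_vector_mult_le[of "M z - M 0" h] by (simp add: matrix_vector_mult_diff_rdistrib)
        also have "\<dots> \<le> \<epsilon> * norm h"
          using r(2) that by (intro mult_right_mono) auto
        finally show "norm (M z *v h - M 0 *v h) \<le> \<epsilon> * norm h" .
      qed
    qed (use xy in auto)
    also have "(F x - M 0 *v x) - (F y - M 0 *v y) = F x - F y - M 0 *v (x - y)"
      by (simp add: matrix_vector_mult_diff_distrib)
    finally show "norm (F x - F y - M 0 *v (x - y)) \<le> \<epsilon> * norm (x - y)" .
  qed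
qed

text \<open>Compactness bounds the derivative on the ball. In \<open>attraction\<close> this makes
  the field cut off by projection globally Lipschitz.\<close>

lemma lipschitz_on_ball:
  obtains L where "L \<ge> 0" "\<And>x y. norm x \<le> r \<Longrightarrow> norm y \<le> r \<Longrightarrow> norm (F x - F y) \<le> L * norm (x - y)"
proof -
  have "compact (M ` cball 0 r)"
    by (intro compact_continuous_image continuous_on_subset[OF M_cont]) auto
  then obtain L where "L > 0" "\<forall>A\<in>M ` cball 0 r. norm A \<le> L"
    using compact_imp_bounded bounded_pos by blast
  then have L: "L > 0" "\<And>x. norm x \<le> r \<Longrightarrow> norm (M x) \<le> L"
    by auto
  have "norm (F x - F y) \<le> L * norm (x - y)" if "norm x \<le> r" "norm y \<le> r" for x y
  proof (rule differentiable_bound[of "cball 0 r" F "\<lambda>x. (*v) (M x)"])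
    show "onorm ((*v) (M z)) \<le> L" if "z \<in> cball 0 r" for z
    proof (rule onorm_le)
      show "norm (M z *v h) \<le> L * norm h" for h
        using norm_matrix_vector_mult_le[of "M z" h] mult_right_mono[OF L(2)[of z], of "norm h"] that
        by simp
    qed
  qed (use that in \<open>auto intro: has_derivative_at_withinI[OF F_deriv]\<close>)
  then show ?thesis
    using L(1) by (intro that[of L]) simp_all
qed

end

locale equilibrium_curve = C1_field +
  fixes \<phi> :: "real \<Rightarrow> real^'n" and k :: "real^'n"
  assumes curve_0: "\<phi> 0 = 0"
    and curve_zero: "F (\<phi> s) = 0"
    and curve_cont: "continuous_on UNIV \<phi>"
    and curve_deriv: "(\<phi> has_vector_derivative k) (at 0)"
    and curve_regular: "k \<noteq> 0"
    and simple_zero: "alg_mult (M 0) 0 = 1"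
    and stable: "eigenvalue (M 0) c \<Longrightarrow> c \<noteq> 0 \<Longrightarrow> Re c < 0"
begin

abbreviation "A \<equiv> M 0"

lemma kernel_tangent: "A *v k = 0"
proof -
  have "((F \<circ> \<phi>) has_derivative (\<lambda>s. A *v (s *\<^sub>R k))) (at 0)"
    unfolding o_def
    by (rule has_derivative_compose[OF curve_deriv[unfolded has_vector_derivative_def]])
      (simp add: curve_0 F_deriv)
  moreover have "((F \<circ> \<phi>) has_derivative (\<lambda>s. 0)) (at 0)"
    by (simp add: o_def curve_zero)
  ultimately have "(\<lambda>s. A *v (s *\<^sub>R k)) = (\<lambda>s. 0)"
    by (rule has_derivative_unique)
  from fun_cong[OF this, of 1] show ?thesis
    by simp
qed

text \<open>The zeros of \<open>F\<close> near \<open>0\<close> are those on the curve. With \<open>l\<close> the left null functional of \<open>A\<close>,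
  a point \<open>y\<close> is compared with the point of the curve at the same level of \<open>l\<close>: their distance is
  of the order of \<open>F y\<close>, so that \<open>l (F y)\<close> is negligible against \<open>F y\<close>.\<close>

lemma near_curve:
  obtains C r where "C > 0" "r > 0"
    "\<And>y. norm y \<le> r \<Longrightarrow> norm (F y) \<le> C * norm (A *v F y)"
    "\<And>y. norm y \<le> r \<Longrightarrow> F y = 0 \<Longrightarrow> \<exists>s. y = \<phi> s"
proof -
  obtain x w where xw: "x \<in> span (range ((*v) A))" "\<And>y. y \<in> span (range ((*v) A)) \<Longrightarrow> orthogonal w y"
    "k = x + w"
    by (rule orthogonal_subspace_decomp_exists[of "range ((*v) A)" k]) (rule that)
  have sub: "subspace (range ((*v) A))"
    by (simp add: linear_subspace_image)
  have "x \<in> range ((*v) A)"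
    using xw(1) unfolding span_eq_iff[THEN iffD2, OF sub] .
  then obtain x' where x': "x = A *v x'"
    by blast
  \<comment> \<open>Otherwise \<open>k\<close> would lie both in the range and in the kernel of
    \<open>A\<close>, which the simple zero excludes. So the orthogonal part \<open>w\<close> of
    \<open>k\<close> defines the left null functional, normalized below to be 1 on
    \<open>k\<close>.\<close>
  have w: "w \<noteq> 0"
  proof
    assume "w = 0"
    then have "A *v (A *v x') = 0" "k = A *v x'"
      using xw(3) x' kernel_tangent by auto
    then show False
      using simple_zero_square_kernel[OF simple_zero, of x'] curve_regular by simp
  qed
  have wk: "w \<bullet> k = w \<bullet> w"
    using xw(2)[OF xw(1)] xw(3) by (simp add: inner_add_right orthogonal_def)
  define l where "l y = (w \<bullet> y) / (w \<bullet> w)" for y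
  have l_linear: "bounded_linear l"
    unfolding l_def by (intro bounded_linear_divide bounded_linear_inner_right bounded_linear_compose[OF bounded_linear_divide])
  interpret l: bounded_linear l
    by (rule l_linear)
  have lk: "l k = 1"
    using w wk by (simp add: l_def)
  have lA: "l (A *v y) = 0" for y
    using xw(2)[of "A *v y"] by (simp add: l_def orthogonal_def span_base)
  have lin: "linear (\<lambda>y. (l y, A *v y))"
    by (intro bounded_linear.linear bounded_linear_Pair l_linear) simp
  \<comment> \<open>The kernel of \<open>A\<close> is spanned by \<open>k\<close>, and
    \<open>l\<close> does not vanish on it. The resulting bound from below lets \<open>l\<close> and
    \<open>A\<close> together control a vector.\<close>
  have inj: "inj (\<lambda>y. (l y, A *v y))"
  proof (subst linear_injective_0[OF lin], intro allI impI)
    fix y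
    assume "(l y, A *v y) = 0"
    then have y: "l y = 0" "A *v y = 0"
      by (simp_all add: zero_prod_def)
    then obtain a where "y = a *\<^sub>R k"
      using simple_zero_kernel[OF simple_zero curve_regular kernel_tangent] by blast
    then show "y = 0"
      using y(1) lk by (simp add: l.scaleR)
  qed
  obtain c where c: "c > 0" "\<And>y. c * norm y \<le> norm (l y, A *v y)"
    by (rule linear_inj_bounded_below_pos[OF lin inj]) (rule that)
  have below: "c * norm y \<le> \<bar>l y\<bar> + norm (A *v y)" for y
    using c(2)[of y] norm_Pair_le[of "l y" "A *v y"] by simp
  obtain N where N: "N > 0" "\<And>y. \<bar>l y\<bar> \<le> N * norm y"
    using l.pos_bounded by (auto simp: mult.commute)
  \<comment> \<open>The first bound absorbs the linearization error and gives c |e| <= 2 |F y|; the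
    second then gives |l (F y)| <= c/2 |F y|, which is absorbed in turn.\<close>
  define \<epsilon> where "\<epsilon> = min (c / 2) (c\<^sup>2 / (4 * N))"
  have \<epsilon>: "\<epsilon> > 0" "\<epsilon> \<le> c / 2" "4 * N * \<epsilon> \<le> c * c"
  proof -
    have "\<epsilon> \<le> c\<^sup>2 / (4 * N)"
      by (simp add: \<epsilon>_def)
    then show "4 * N * \<epsilon> \<le> c * c"
      using N(1) by (simp add: pos_le_divide_eq power2_eq_square mult_ac)
  qed (use c(1) N(1) in \<open>simp_all add: \<epsilon>_def\<close>)
  obtain r0 where r0: "r0 > 0" "\<And>x. norm x \<le> r0 \<Longrightarrow> norm (M x - A) \<le> \<epsilon>"
    "\<And>x y. norm x \<le> r0 \<Longrightarrow> norm y \<le> r0 \<Longrightarrow> norm (F x - F y - A *v (x - y)) \<le> \<epsilon> * norm (x - y)"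
    by (rule strict_derivative_at_0[OF \<epsilon>(1)]) (rule that)
  have "isCont \<phi> 0"
    using curve_cont by (simp add: continuous_on_eq_continuous_at)
  then obtain s0 where s0: "s0 > 0" "\<And>s. \<bar>s\<bar> < s0 \<Longrightarrow> norm (\<phi> s) < r0"
    using r0(1) unfolding continuous_at_eps_delta by (auto simp: dist_norm curve_0)
  have "((\<lambda>s. l (\<phi> s)) has_vector_derivative l k) (at 0)"
    by (rule bounded_linear.has_vector_derivative[OF l_linear curve_deriv])
  then have der: "((\<lambda>s. l (\<phi> s)) has_real_derivative 1) (at 0)"
    by (simp add: lk has_real_derivative_iff_has_vector_derivative)
  obtain d1 where d1: "d1 > 0" "\<And>h. 0 < h \<Longrightarrow> h < d1 \<Longrightarrow> l (\<phi> 0) < l (\<phi> (0 + h))"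
    using DERIV_pos_inc_right[OF der] by auto
  obtain d2 where d2: "d2 > 0" "\<And>h. 0 < h \<Longrightarrow> h < d2 \<Longrightarrow> l (\<phi> (0 - h)) < l (\<phi> 0)"
    using DERIV_pos_inc_left[OF der] by auto
  define s1 where "s1 = min s0 (min d1 d2) / 2"
  have s1: "0 < s1" "s1 < s0" "s1 < d1" "s1 < d2"
    using s0(1) d1(1) d2(1) by (auto simp: s1_def)
  \<comment> \<open>Since \<open>l\<close> increases along the curve at 0, the levels at
    \<open>s1\<close> and \<open>- s1\<close> have opposite signs; by the intermediate value theorem
    every level of size at most \<eta> is attained in between.\<close>
  define \<eta> where "\<eta> = min (l (\<phi> s1)) (- l (\<phi> (- s1)))"
  have \<eta>: "\<eta> > 0"
    using d1(2)[of s1] d2(2)[of s1] s1 by (simp add: \<eta>_def curve_0 l.zero)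
  define r where "r = min r0 (\<eta> / N)"
  have r: "r > 0" "r \<le> r0" "N * r \<le> \<eta>"
  proof -
    have "r \<le> \<eta> / N"
      by (simp add: r_def)
    then show "N * r \<le> \<eta>"
      using N(1) by (simp add: pos_le_divide_eq mult.commute)
  qed (use r0(1) \<eta> N(1) in \<open>simp_all add: r_def\<close>)
  have match: "\<exists>s. norm (\<phi> s) \<le> r0 \<and> l (\<phi> s) = l y" if "norm y \<le> r" for y
  proof -
    have "\<bar>l y\<bar> \<le> \<eta>"
      using N(2)[of y] mult_left_mono[OF that, of N] N(1) r(3) by linarith
    then have "l (\<phi> (- s1)) \<le> l y" "l y \<le> l (\<phi> s1)"
      by (auto simp: \<eta>_def)
    then obtain s where "- s1 \<le> s" "s \<le> s1" "l (\<phi> s) = l y"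
      using IVT'[of "\<lambda>s. l (\<phi> s)" "- s1" "l y" s1] s1(1)
        l.continuous_on[OF continuous_on_subset[OF curve_cont]] by auto
    moreover have "norm (\<phi> s) < r0"
      using calculation s0(2) s1(2) by auto
    ultimately show ?thesis
      by (intro exI[of _ s]) simp
  qed
  have main: "norm (F y) \<le> 2 / c * norm (A *v F y) \<and> (F y = 0 \<longrightarrow> (\<exists>s. y = \<phi> s))" if y: "norm y \<le> r" for y
  proof -
    obtain s where s: "norm (\<phi> s) \<le> r0" "l (\<phi> s) = l y"
      using match[OF y] by blast
    define e where "e = y - \<phi> s"
    define q where "q = F y - A *v e"
    have le: "l e = 0"
      using s(2) by (simp add: e_def l.diff)
    have q: "norm q \<le> \<epsilon> * norm e"
      using r0(3)[of y "\<phi> s"] y r(2) s(1) by (simp add: q_def e_def curve_zero)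
    have "c * norm e \<le> norm (A *v e)"
      using below[of e] le by simp
    also have "A *v e = F y - q"
      by (simp add: q_def)
    also have "norm (F y - q) \<le> norm (F y) + \<epsilon> * norm e"
      using norm_triangle_ineq4[of "F y" q] q by linarith
    also have "\<epsilon> * norm e \<le> c / 2 * norm e"
      using \<epsilon>(2) by (intro mult_right_mono) auto
    finally have e: "c * norm e \<le> 2 * norm (F y)"
      by simp
    have "l (F y) = l q"
      by (simp add: q_def l.diff lA)
    then have "\<bar>l (F y)\<bar> \<le> N * (\<epsilon> * norm e)"
      using N(2)[of q] mult_left_mono[OF q, of N] N(1) by linarith
    then have "4 * (c * \<bar>l (F y)\<bar>) \<le> (4 * N * \<epsilon>) * (c * norm e)"
      using c(1) by simp
    also have "\<dots> \<le> (c * c) * (2 * norm (F y))"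
      by (rule mult_mono[OF \<epsilon>(3) e]) (use c(1) in simp_all)
    finally have "2 * \<bar>l (F y)\<bar> \<le> c * norm (F y)"
      using c(1) by simp
    then have "norm (F y) \<le> 2 / c * norm (A *v F y)"
      using below[of "F y"] c(1) by (simp add: field_simps)
    moreover have "y = \<phi> s" if "F y = 0"
      using e that c(1) by (simp add: e_def mult_le_0_iff)
    ultimately show ?thesis
      by blast
  qed
  show ?thesis
    by (rule that[of "2 / c" r]) (use c(1) r(1) main in auto)
qed

text \<open>Along a trajectory, \<open>g = F (c t)\<close> satisfies \<open>g' = M (c t) g\<close>, so the form \<open>B\<close> makes the velocity
  decay exponentially; the trajectory therefore has finite length, proportional to \<open>F (c 0)\<close>.\<close>

theorem local_convergence:
  assumes "\<rho> > 0"
  obtains \<delta> where "\<delta> > 0"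
    "\<And>c. norm (c 0) \<le> \<delta> \<Longrightarrow> continuous_on {0..} c \<Longrightarrow>
      \<forall>t\<ge>0. norm (c t) \<le> \<rho> \<longrightarrow> (c has_vector_derivative F (c t)) (at t within {0..}) \<Longrightarrow>
      (\<forall>t\<ge>0. norm (c t) < \<rho>) \<and> (\<exists>s. (c \<longlongrightarrow> \<phi> s) at_top)"
proof -
  obtain B a K where B: "bounded_bilinear B" "\<And>x y. B x y = B y x" and a: "a > (0::real)" and K: "K > 0"
    and B_lower: "\<And>x. (norm (A *v x))\<^sup>2 \<le> B x x"
    and B_decay: "\<And>x. B x (A *v x) \<le> - a * (norm (A *v x))\<^sup>2"
    and B_upper: "\<And>x y. \<bar>B x y\<bar> \<le> K * norm (A *v x) * norm (A *v y)"
    by (rule simple_zero_lyapunov_form[OF simple_zero stable]) (assumption, assumption, rule that)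
  obtain C r0 where C: "C > 0" and r0: "r0 > 0"
    and near: "\<And>y. norm y \<le> r0 \<Longrightarrow> norm (F y) \<le> C * norm (A *v F y)"
    and zero: "\<And>y. norm y \<le> r0 \<Longrightarrow> F y = 0 \<Longrightarrow> \<exists>s. y = \<phi> s"
    by (rule near_curve) (rule that)
  \<comment> \<open>Replacing \<open>A\<close> by \<open>M x\<close> costs at most a/2 |A g|^2, half
    of the decay. The added 1 keeps the denominator positive even when \<open>A\<close>
    vanishes.\<close>
  define \<epsilon> where "\<epsilon> = a / (2 * K * (norm A + 1) * C)"
  have nA: "norm A + 1 > 0"
    by (simp add: add_nonneg_pos)
  have \<epsilon>: "\<epsilon> > 0" "K * (norm A + 1) * C * \<epsilon> = a / 2"
    using a K C nA by (simp_all add: \<epsilon>_def)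
  obtain r1 where r1: "r1 > 0" "\<And>x. norm x \<le> r1 \<Longrightarrow> norm (M x - A) \<le> \<epsilon>"
    "\<And>x y. norm x \<le> r1 \<Longrightarrow> norm y \<le> r1 \<Longrightarrow> norm (F x - F y - A *v (x - y)) \<le> \<epsilon> * norm (x - y)"
    by (rule strict_derivative_at_0[OF \<epsilon>(1)]) (rule that)
  define r where "r = min \<rho> (min r0 r1)"
  have r: "r > 0" "r \<le> \<rho>" "r \<le> r0" "r \<le> r1"
    using assms r0 r1(1) by (simp_all add: r_def)
  \<comment> \<open>What remains is a derivative of at most -a |A g|^2 for B g g, and B g g <= K |A
    g|^2, so the form decays at rate 2 b and the velocity at rate b. Integrating the velocity bound
    gives a length of at most \<open>N\<close> times the initial speed.\<close>
  define b where "b = a / (2 * K)"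
  have b: "b > 0"
    using a K by (simp add: b_def)
  define N where "N = C * sqrt K * norm A / b"
  have N: "N \<ge> 0"
    using b C K by (simp add: N_def)
  define L where "L = \<epsilon> + norm A"
  have L: "L \<ge> 0"
    using \<epsilon>(1) by (simp add: L_def)
  have F_le: "norm (F x) \<le> L * norm x" if "norm x \<le> r" for x
  proof -
    have "norm (F x) \<le> norm (F x - A *v x) + norm (A *v x)"
      using norm_triangle_sub[of "F x" "A *v x"] by simp
    also have "norm (F x - A *v x) \<le> \<epsilon> * norm x"
      using r1(3)[of x 0] that r r1(1) curve_zero[of 0] by (simp add: curve_0)
    also have "norm (A *v x) \<le> norm A * norm x"
      by (rule norm_matrix_vector_mult_le)
    finally show ?thesis
      by (simp add: L_def algebra_simps)
  qed
  \<comment> \<open>Initial distance plus travelled length is at most (1 + N L) \<delta> = r / 2,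
    strictly inside the ball of radius \<open>r\<close>.\<close>
  define \<delta> where "\<delta> = r / 2 / (1 + N * L)"
  have NL: "1 + N * L > 0"
    using N L by (simp add: add_pos_nonneg)
  have \<delta>: "\<delta> > 0" "\<delta> + N * (L * \<delta>) < r"
  proof -
    show "\<delta> > 0"
      using r(1) NL by (simp add: \<delta>_def)
    have "\<delta> + N * (L * \<delta>) = (1 + N * L) * \<delta>"
      by (simp add: algebra_simps)
    also have "\<dots> = r / 2"
      using NL by (metis \<delta>_def less_irrefl nonzero_mult_div_cancel_left times_divide_eq_right)
    finally show "\<delta> + N * (L * \<delta>) < r"
      using r(1) by simp
  qed
  have \<delta>_le: "\<delta> \<le> r"
  proof -
    have "0 \<le> N * (L * \<delta>)"
      using \<delta>(1) N L by simp
    then show ?thesis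
      using \<delta>(2) by linarith
  qed
  have lyapunov: "2 * B (F x) (M x *v F x) \<le> - (2 * b) * B (F x) (F x)" if x: "norm x \<le> r" for x
  proof -
    define g where "g = F x"
    define E where "E = M x - A"
    have "M x *v g = A *v g + E *v g"
      by (simp add: E_def matrix_vector_mult_diff_rdistrib)
    then have split: "B g (M x *v g) = B g (A *v g) + B g (E *v g)"
      by (simp add: bounded_bilinear.add_right[OF B(1)])
    have "norm (E *v g) \<le> \<epsilon> * (C * norm (A *v g))"
    proof -
      have "norm (E *v g) \<le> norm E * norm g"
        by (rule norm_matrix_vector_mult_le)
      also have "\<dots> \<le> \<epsilon> * (C * norm (A *v g))"
        using r1(2)[of x] near[of x] x r \<epsilon>(1) by (intro mult_mono) (auto simp: E_def g_def)
      finally show ?thesis .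
    qed
    then have "norm (A *v (E *v g)) \<le> (norm A + 1) * (\<epsilon> * (C * norm (A *v g)))"
      by (intro order_trans[OF norm_matrix_vector_mult_le[of A]] mult_mono[of _ _ "norm (E *v g)"]) auto
    then have "K * norm (A *v g) * norm (A *v (E *v g)) \<le>
        K * norm (A *v g) * ((norm A + 1) * (\<epsilon> * (C * norm (A *v g))))"
      using K by (intro mult_left_mono) auto
    also have "\<dots> = (K * (norm A + 1) * C * \<epsilon>) * (norm (A *v g))\<^sup>2"
      by (simp add: power2_eq_square mult_ac)
    finally have "B g (E *v g) \<le> a / 2 * (norm (A *v g))\<^sup>2"
      using B_upper[of g "E *v g"] unfolding \<epsilon>(2) by linarith
    then have "2 * B g (M x *v g) \<le> - (a * (norm (A *v g))\<^sup>2)"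
      using B_decay[of g] split by simp
    also have "a * (norm (A *v g))\<^sup>2 = 2 * b * (K * (norm (A *v g))\<^sup>2)"
      using K by (simp add: b_def)
    also have "- \<dots> \<le> - (2 * b * B g g)"
      using B_upper[of g g] b by (simp add: power2_eq_square mult.assoc)
    finally show ?thesis
      by (simp add: g_def)
  qed
  show ?thesis
  proof (rule that[OF \<delta>(1)])
    fix c :: "real \<Rightarrow> real^'n"
    assume c0: "norm (c 0) \<le> \<delta>" and cont: "continuous_on {0..} c"
      and "\<forall>t\<ge>0. norm (c t) \<le> \<rho> \<longrightarrow> (c has_vector_derivative F (c t)) (at t within {0..})"
    then have ode: "(c has_vector_derivative F (c t)) (at t within {0..})" if "t \<ge> 0" "norm (c t) \<le> \<rho>" for t
      using that by blast
    define H where "H = b * N * norm (F (c 0))"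
    have H: "H \<ge> 0" "H / b \<le> N * (L * \<delta>)"
    proof -
      show "H \<ge> 0"
        using b N by (simp add: H_def)
      have "norm (F (c 0)) \<le> L * \<delta>"
        using F_le[of "c 0"] c0 \<delta>_le mult_left_mono[OF c0 L] by linarith
      then show "H / b \<le> N * (L * \<delta>)"
        using b mult_left_mono[OF _ N] by (simp add: H_def)
    qed
    have interior: "at t within {0..} = at t" if "t > 0" for t :: real
      by (rule at_within_interior) (use that in \<open>simp add: interior_real_atLeast\<close>)
    define V where "V t = B (F (c t)) (F (c t))" for t
    have contF: "continuous_on {0..} (\<lambda>t. F (c t))"
      by (rule continuous_on_compose2[OF F_cont[of UNIV] cont]) simp
    have decay: "norm (F (c t)) \<le> H * exp (- b * t)"
      if t: "t \<ge> 0" "norm (c t) \<le> r" "\<And>s. 0 \<le> s \<Longrightarrow> s < t \<Longrightarrow> norm (c s) \<le> r" for t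
    proof -
      \<comment> \<open>Gronwall argument with an integrating factor: V' <= -2 b V makes this
        product nonincreasing.\<close>
      have "exp (2 * b * t) * V t \<le> exp (2 * b * 0) * V 0"
      proof (rule DERIV_nonpos_imp_decreasing_open[OF t(1)])
        show "continuous_on {0..t} (\<lambda>t. exp (2 * b * t) * V t)"
          unfolding V_def
          by (intro continuous_intros bounded_bilinear.continuous_on[OF B(1)] continuous_on_subset[OF contF]) auto
        fix s
        assume s: "0 < s" "s < t"
        have cs: "norm (c s) \<le> r"
          using t(3) s by simp
        have "(c has_vector_derivative F (c s)) (at s)"
          using ode[of s] cs r(2) s interior by simp
        then have "(F \<circ> c has_vector_derivative M (c s) *v F (c s)) (at s)"
          using vector_derivative_diff_chain_within[of c _ s UNIV F] has_derivative_at_withinI[OF F_deriv] by fastforce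
        then have dF: "((\<lambda>t. F (c t)) has_vector_derivative M (c s) *v F (c s)) (at s)"
          by (simp add: o_def)
        have "(V has_vector_derivative (B (F (c s)) (M (c s) *v F (c s)) + B (M (c s) *v F (c s)) (F (c s)))) (at s)"
          unfolding V_def by (rule bounded_bilinear.has_vector_derivative[OF B(1) dF dF])
        then have dV: "(V has_real_derivative 2 * B (F (c s)) (M (c s) *v F (c s))) (at s)"
          by (simp add: has_real_derivative_iff_has_vector_derivative B(2)[of _ "F (c s)"])
        show "\<exists>y. ((\<lambda>t. exp (2 * b * t) * V t) has_real_derivative y) (at s) \<and> y \<le> 0"
        proof (intro exI conjI)
          show "((\<lambda>t. exp (2 * b * t) * V t) has_real_derivative
              exp (2 * b * s) * (2 * B (F (c s)) (M (c s) *v F (c s)) + 2 * b * V s)) (at s)"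
            by (rule derivative_eq_intros dV refl)+ (simp add: algebra_simps)
          show "exp (2 * b * s) * (2 * B (F (c s)) (M (c s) *v F (c s)) + 2 * b * V s) \<le> 0"
            using lyapunov[OF cs] by (simp add: V_def mult_le_0_iff)
        qed
      qed
      then have "V t \<le> V 0 * exp (- (2 * b * t))"
        by (simp add: exp_minus field_simps)
      also have "V 0 \<le> K * (norm A * norm (F (c 0)))\<^sup>2"
      proof -
        have "V 0 \<le> K * (norm (A *v F (c 0)))\<^sup>2"
          using B_upper[of "F (c 0)" "F (c 0)"] by (simp add: V_def power2_eq_square mult.assoc)
        also have "\<dots> \<le> K * (norm A * norm (F (c 0)))\<^sup>2"
          using K by (intro mult_left_mono power_mono norm_matrix_vector_mult_le) auto
        finally show ?thesis .
      qed
      also have "(norm (A *v F (c t)))\<^sup>2 \<le> V t"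
        unfolding V_def by (rule B_lower)
      finally have "(norm (A *v F (c t)))\<^sup>2 \<le> K * (norm A * norm (F (c 0)))\<^sup>2 * exp (- (2 * b * t))"
        by simp
      also have "\<dots> = (sqrt K * norm A * norm (F (c 0)) * exp (- b * t))\<^sup>2"
        using K by (simp add: power_mult_distrib flip: exp_double)
      finally have AF: "norm (A *v F (c t)) \<le> sqrt K * norm A * norm (F (c 0)) * exp (- b * t)"
        by (rule power2_le_imp_le) (use K in simp)
      have "norm (F (c t)) \<le> C * norm (A *v F (c t))"
        using near t(2) r(3) by simp
      also have "\<dots> \<le> C * (sqrt K * norm A * norm (F (c 0)) * exp (- b * t))"
        using AF C by (intro mult_left_mono) simp_all
      also have "\<dots> = H * exp (- b * t)"
        using b by (simp add: H_def N_def)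
      finally show ?thesis .
    qed
    have travel: "norm (c t - c s) \<le> H / b * exp (- b * s)"
      if s: "0 \<le> s" "s < t" and ct: "\<And>u. 0 \<le> u \<Longrightarrow> u < t \<Longrightarrow> norm (c u) \<le> r" for s t
    proof -
      have "norm (c t - c s) \<le> - (H / b) * exp (- b * t) - - (H / b) * exp (- b * s)"
      proof (rule differentiable_bound_general[OF s(2)])
        show "continuous_on {s..t} c"
          using s(1) by (intro continuous_on_subset[OF cont]) auto
        show "continuous_on {s..t} (\<lambda>t. - (H / b) * exp (- b * t))"
          by (intro continuous_intros)
        fix u
        assume u: "s < u" "u < t"
        show "(c has_vector_derivative F (c u)) (at u)"
          using ode[of u] ct[of u] r(2) u s(1) interior by simp
        show "((\<lambda>t. - (H / b) * exp (- b * t)) has_vector_derivative H * exp (- b * u)) (at u)"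
          unfolding has_real_derivative_iff_has_vector_derivative[symmetric]
          using b by (auto intro!: derivative_eq_intros)
        show "norm (F (c u)) \<le> H * exp (- b * u)"
          using decay[of u] ct u s(1) by simp
      qed
      also have "\<dots> \<le> H / b * exp (- b * s)"
        using H(1) b by simp
      finally show ?thesis .
    qed
    have stays: "norm (c t) < r" if ct: "0 \<le> t" "\<And>u. 0 \<le> u \<Longrightarrow> u < t \<Longrightarrow> norm (c u) < r" for t
    proof (cases "t = 0")
      case True
      then show ?thesis
        using c0 \<delta>(1,2) mult_nonneg_nonneg[OF N mult_nonneg_nonneg[OF L less_imp_le[OF \<delta>(1)]]] by simp
    next
      case False
      then have "norm (c t - c 0) \<le> H / b"
        using travel[of 0 t] ct by (simp add: less_imp_le)
      then show ?thesis
        using c0 \<delta>(2) H(2) norm_triangle_sub[of "c t" "c 0"] by linarith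
    qed
    have inside: "norm (c t) < r" if "t \<ge> 0" for t
    proof (rule ccontr)
      assume "\<not> norm (c t) < r"
      \<comment> \<open>The least element of this compact set is the first exit time from the open
        ball. Up to then the estimates hold, and \<open>stays\<close> contradicts the exit.\<close>
      define S where "S = {0..t} \<inter> (\<lambda>t. norm (c t)) -` {r..}"
      have "closed S"
        unfolding S_def
        by (intro continuous_closed_preimage continuous_intros continuous_on_subset[OF cont]) auto
      then have "compact S"
        unfolding S_def by (metis bounded_Int bounded_closed_interval compact_eq_bounded_closed)
      moreover have "t \<in> S"
        using that \<open>\<not> norm (c t) < r\<close> by (simp add: S_def)
      ultimately obtain \<tau> where \<tau>: "\<tau> \<in> S" "\<And>u. u \<in> S \<Longrightarrow> \<tau> \<le> u"
        using compact_attains_inf[of S] by blast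
      have "norm (c u) < r" if "0 \<le> u" "u < \<tau>" for u
        using \<tau>(1) \<tau>(2)[of u] that by (force simp: S_def)
      then show False
        using stays[of \<tau>] \<tau>(1) by (auto simp: S_def)
    qed
    have cauchy: "norm (c t - c s) \<le> H / b * exp (- b * s)" if "0 \<le> s" "s \<le> t" for s t
      using travel[of s t] that inside H(1) b by (cases "s = t") (simp_all add: less_imp_le)
    have tail: "((\<lambda>t. H / b * exp (- b * t)) \<longlongrightarrow> 0) at_top"
      using tendsto_mult_right_zero[OF exp_decay_tendsto_0[OF b]] .
    \<comment> \<open>Completeness is applied along integer times; the bound \<open>cauchy\<close>
      then carries the limit over to real times.\<close>
    have "Cauchy (\<lambda>n. c (real n))"
    proof (rule CauchyI')
      fix e :: real
      assume "e > 0"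
      then have "\<forall>\<^sub>F n in sequentially. H / b * exp (- b * real n) < e"
        using order_tendstoD(2)[OF filterlim_compose[OF tail filterlim_real_sequentially]] by blast
      then obtain n where "H / b * exp (- b * real n) < e" and n: "\<And>m. m \<ge> n \<Longrightarrow> H / b * exp (- b * real m) < e"
        by (auto simp: eventually_sequentially)
      then have "norm (c (real m) - c (real p)) < e" if "n \<le> m" "m < p" for m p
        using le_less_trans[OF cauchy[of "real m" "real p"] n[of m]] that by (simp add: norm_minus_commute)
      then show "\<exists>n. \<forall>m\<ge>n. \<forall>p>m. dist (c (real m)) (c (real p)) < e"
        unfolding dist_norm by blast
    qed
    then obtain l where l: "(\<lambda>n. c (real n)) \<longlonglongrightarrow> l"
      using Cauchy_convergent convergent_def by blast
    have limit: "norm (c t - l) \<le> H / b * exp (- b * t)" if "t \<ge> 0" for t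
      unfolding norm_minus_commute[of "c t" l]
    proof (rule LIMSEQ_le_const2)
      show "(\<lambda>n. norm (c (real n) - c t)) \<longlonglongrightarrow> norm (l - c t)"
        by (intro tendsto_intros l)
      show "\<exists>N. \<forall>n\<ge>N. norm (c (real n) - c t) \<le> H / b * exp (- b * t)"
        using cauchy[of t] that by (intro exI[of _ "nat \<lceil>t\<rceil>"]) (simp add: nat_ceiling_le_eq)
    qed
    then have "\<forall>\<^sub>F t in at_top. norm (c t - l) \<le> H / b * exp (- b * t)"
      by (rule eventually_at_top_linorderI[of 0])
    then have "((\<lambda>t. c t - l) \<longlongrightarrow> 0) at_top"
      using tail by (rule Lim_null_comparison)
    then have lim: "(c \<longlongrightarrow> l) at_top"
      by (rule LIM_zero_cancel)
    \<comment> \<open>The velocity tends both to F l and to 0, so the limit is a zero of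
      \<open>F\<close> in the small ball and hence a point of the curve.\<close>
    have "((\<lambda>t. F (c t)) \<longlongrightarrow> F l) at_top"
      by (rule continuous_on_tendsto_compose[OF F_cont[of UNIV] lim]) auto
    moreover have "((\<lambda>t. F (c t)) \<longlongrightarrow> 0) at_top"
    proof (rule Lim_null_comparison)
      show "((\<lambda>t. H * exp (- b * t)) \<longlongrightarrow> 0) at_top"
        using tendsto_mult_right_zero[OF exp_decay_tendsto_0[OF b]] .
      show "\<forall>\<^sub>F t in at_top. norm (F (c t)) \<le> H * exp (- b * t)"
        by (rule eventually_at_top_linorderI[of 0]) (use decay inside in \<open>simp add: less_imp_le\<close>)
    qed
    ultimately have "F l = 0"
      using tendsto_unique trivial_limit_at_top_linorder by blast
    moreover have "norm l \<le> r"
      by (rule tendsto_upperbound[OF tendsto_norm[OF lim]])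
        (auto intro!: eventually_at_top_linorderI[of 0] less_imp_le inside)
    ultimately have "\<exists>s. l = \<phi> s"
      using zero r(3) by simp
    then show "(\<forall>t\<ge>0. norm (c t) < \<rho>) \<and> (\<exists>s. (c \<longlongrightarrow> \<phi> s) at_top)"
      using lim inside r(2) by fastforce
  qed
qed

text \<open>Existence comes from the field composed with the nonexpansive projection onto the ball
  of radius \<rho>. Its solutions obey the true equation while inside the ball, which is all that
  \<open>local_convergence\<close> asks for; they therefore never leave it, and the projection is
  the identity along them.\<close>

theorem attraction:
  assumes "\<rho> > 0"
  obtains \<delta> where "\<delta> > 0"
    "\<And>c. norm (c 0) \<le> \<delta> \<Longrightarrow> \<forall>t\<ge>0. (c has_vector_derivative F (c t)) (at t within {0..}) \<Longrightarrow>
      (\<forall>t\<ge>0. norm (c t) < \<rho>) \<and> (\<exists>s. (c \<longlongrightarrow> \<phi> s) at_top)"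
    "\<And>x. norm x \<le> \<delta> \<Longrightarrow> \<exists>c. c 0 = x \<and> (\<forall>t\<ge>0. (c has_vector_derivative F (c t)) (at t within {0..}))"
proof -
  obtain \<delta> where \<delta>: "\<delta> > 0"
    "\<And>c. norm (c 0) \<le> \<delta> \<Longrightarrow> continuous_on {0..} c \<Longrightarrow>
      \<forall>t\<ge>0. norm (c t) \<le> \<rho> \<longrightarrow> (c has_vector_derivative F (c t)) (at t within {0..}) \<Longrightarrow>
      (\<forall>t\<ge>0. norm (c t) < \<rho>) \<and> (\<exists>s. (c \<longlongrightarrow> \<phi> s) at_top)"
    by (rule local_convergence[OF assms]) (rule that)
  have cont: "continuous_on {0..} c"
    if "\<forall>t\<ge>0. (c has_vector_derivative f t) (at t within {0..})" for c f
    using that by (auto simp: continuous_on_eq_continuous_within intro!: has_vector_derivative_continuous)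
  let ?p = "closest_point (cball 0 \<rho>) :: real^'n \<Rightarrow> real^'n"
  have p_in: "norm (?p x) \<le> \<rho>" for x
    using closest_point_in_set[of "cball 0 \<rho>" x] assms by simp
  obtain L where L: "L \<ge> 0"
    "\<And>x y. norm x \<le> \<rho> \<Longrightarrow> norm y \<le> \<rho> \<Longrightarrow> norm (F x - F y) \<le> L * norm (x - y)"
    by (rule lipschitz_on_ball[of \<rho>]) (rule that)
  have lip: "norm (F (?p x) - F (?p y)) \<le> L * norm (x - y)" for x y
  proof -
    have "norm (F (?p x) - F (?p y)) \<le> L * norm (?p x - ?p y)"
      by (intro L(2) p_in)
    also have "\<dots> \<le> L * norm (x - y)"
      using closest_point_lipschitz[of "cball 0 \<rho>" x y] assms L(1)
      by (intro mult_left_mono) (simp_all add: dist_norm)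
    finally show ?thesis .
  qed
  show ?thesis
  proof (rule that[OF \<delta>(1)])
    show "(\<forall>t\<ge>0. norm (c t) < \<rho>) \<and> (\<exists>s. (c \<longlongrightarrow> \<phi> s) at_top)"
      if "norm (c 0) \<le> \<delta>" "\<forall>t\<ge>0. (c has_vector_derivative F (c t)) (at t within {0..})" for c
      using \<delta>(2)[OF that(1) cont[OF that(2)]] that(2) by simp
    show "\<exists>c. c 0 = x \<and> (\<forall>t\<ge>0. (c has_vector_derivative F (c t)) (at t within {0..}))"
      if x: "norm x \<le> \<delta>" for x
    proof -
      obtain c where c: "c 0 = x" "\<And>t. t \<ge> 0 \<Longrightarrow> (c has_vector_derivative F (?p (c t))) (at t within {0..})"
        by (rule picard_global[OF lip L(1), of x]) (rule that)
      have p: "?p (c t) = c t" if "norm (c t) \<le> \<rho>" for t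
        using that by (intro closest_point_self) simp
      have "continuous_on {0..} c"
        by (rule cont[of c "\<lambda>t. F (?p (c t))"]) (simp add: c(2))
      moreover have "\<forall>t\<ge>0. norm (c t) \<le> \<rho> \<longrightarrow> (c has_vector_derivative F (c t)) (at t within {0..})"
        using c(2) p by metis
      ultimately have "\<forall>t\<ge>0. norm (c t) < \<rho>"
        using \<delta>(2)[of c] c(1) x by simp
      then have "(c has_vector_derivative F (c t)) (at t within {0..})" if "t \<ge> 0" for t
        using c(2)[OF that] p[of t] that by (simp add: less_imp_le)
      then show ?thesis
        using c(1) by blast
    qed
  qed
qed

end

section \<open>Rotational symmetry of the converter network\<close>

lemma unit_complex_add: "unit_complex (a + b) = unit_complex a * unit_complex b"
  by (simp add: plus_circle_def Abs_circle_inverse norm_mult)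

lemma unit_complex_zero [simp]: "unit_complex 0 = 1"
  by (simp add: zero_circle_def Abs_circle_inverse)

lemma ang_0 [simp]: "ang 0 = 0"
  by (simp add: unit_complex_inject[symmetric])

lemma ccos_add: "ccos (a + b) = ccos a * ccos b - csin a * csin b"
  and csin_add: "csin (a + b) = csin a * ccos b + ccos a * csin b"
  by (simp_all add: ccos_def csin_def unit_complex_add)

lemma ccos_0 [simp]: "ccos 0 = 1" and csin_0 [simp]: "csin 0 = 0"
  by (simp_all add: ccos_def csin_def)

lemma ccos_csin_squared: "(ccos a)\<^sup>2 + (csin a)\<^sup>2 = 1"
  using norm_unit_complex[of a] by (simp add: ccos_def csin_def cmod_def)

lemma dist_circle_add_right: "dist (a + \<theta>) (b + \<theta>) = dist a (b::circle)"
proof -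
  have "dist (a + \<theta>) (b + \<theta>) = norm ((unit_complex a - unit_complex b) * unit_complex \<theta>)"
    by (simp add: dist_circle_def unit_complex_add dist_norm left_diff_distrib)
  then show ?thesis
    by (simp add: norm_mult dist_circle_def dist_norm)
qed

lemma tendsto_circle_iff:
  "(f \<longlongrightarrow> a) F \<longleftrightarrow> ((\<lambda>x. unit_complex (f x)) \<longlongrightarrow> unit_complex a) F"
  by (simp add: tendsto_iff dist_circle_def)

text \<open>The principal argument is continuous at 1, and invariance of the metric reduces any pair
  to its difference, so one \<open>d\<close> serves all pairs.\<close>

lemma circle_lift_small:
  assumes "e > 0"
  obtains d where "d > 0" "\<And>a b. dist a b < d \<Longrightarrow> \<exists>x. \<bar>x\<bar> < e \<and> a = b + ang x"
proof -
  have "isCont Arg 1"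
    by (rule continuous_at_Arg) (simp add: complex_nonpos_Reals_iff)
  then obtain d where d: "d > 0" "\<And>z. dist z 1 < d \<Longrightarrow> \<bar>Arg z\<bar> < e"
    using assms unfolding continuous_at_eps_delta by (auto simp: dist_norm)
  have "\<exists>x. \<bar>x\<bar> < e \<and> a = b + ang x" if "dist a b < d" for a b
  proof -
    have "dist (a - b) 0 < d"
      using that dist_circle_add_right[of "a - b" b 0] by simp
    then have "\<bar>Arg (unit_complex (a - b))\<bar> < e"
      using d(2) by (simp add: dist_circle_def)
    moreover have "ang (Arg (unit_complex (a - b))) = a - b"
      by (simp add: unit_complex_inject[symmetric] cis_Arg sgn_eq)
        (metis cis_Arg div_by_1 norm_unit_complex norm_zero of_real_1 sgn_eq zero_neq_one)
    ultimately show ?thesis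
      by (intro exI[of _ "Arg (unit_complex (a - b))"]) simp
  qed
  then show ?thesis
    using d(1) by (intro that) auto
qed

section \<open>Blockwise planar rotations\<close>

lemma sum_times_2: "(\<Sum>p\<in>UNIV. f p) = (\<Sum>k\<in>UNIV. f (k, 1) + f (k, 2))"
  for f :: "'a::finite \<times> 2 \<Rightarrow> 'b::comm_monoid_add"
proof -
  have "(\<Sum>p\<in>UNIV. f p) = (\<Sum>k\<in>UNIV. \<Sum>a\<in>UNIV. f (k, a))"
    by (simp add: sum.cartesian_product)
  then show ?thesis
    by (simp add: sum_2)
qed

lemma vec_times_2_eq_iff: "x = y \<longleftrightarrow> (\<forall>k. x $ (k, 1) = y $ (k, 1) \<and> x $ (k, 2) = y $ (k, 2))"
  for x y :: "'b^('a::finite \<times> 2)"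
  by (auto simp: vec_eq_iff forall_2)

lemma JJ_mult_component [simp]:
  "(JJ *v x) $ (k, 1) = - x $ (k, 2)" "(JJ *v x) $ (k, 2) = x $ (k, 1)"
  by (simp_all add: JJ_def kron_def J2_def matrix_vector_mult_def sum_times_2 mat_def if_distrib
      [of "\<lambda>c. c * _"] cong: if_cong)

text \<open>The rotation is cos I + sin J, so commutation with rotations reduces to commutation with
  \<open>JJ\<close>.\<close>

lemma RR_mult_vec: "RR \<theta> *v x = ccos \<theta> *\<^sub>R x + csin \<theta> *\<^sub>R (JJ *v x)"
  by (simp add: vec_times_2_eq_iff)
    (simp add: RR_def kron_def rot2_def matrix_vector_mult_def sum_times_2 sum.distrib mat_def if_distrib
      [of "\<lambda>c. c * _"] cong: if_cong)

lemma JJ_skew: "(JJ *v x) \<bullet> y = - (x \<bullet> (JJ *v y))"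
  by (simp add: inner_vec_def sum_times_2 sum_negf[symmetric] algebra_simps)

lemma JJ_JJ_mult_vec [simp]: "JJ *v (JJ *v x) = - x"
  by (simp add: vec_times_2_eq_iff)

lemma norm_RR_mult_vec [simp]: "norm (RR \<theta> *v x) = norm x"
proof -
  have orth: "x \<bullet> (JJ *v x) = 0"
    using JJ_skew[of x x] by (simp add: inner_commute)
  moreover have "(JJ *v x) \<bullet> (JJ *v x) = x \<bullet> x"
    by (simp add: JJ_skew)
  ultimately have "(RR \<theta> *v x) \<bullet> (RR \<theta> *v x) = ((ccos \<theta>)\<^sup>2 + (csin \<theta>)\<^sup>2) * (x \<bullet> x)"
    by (simp add: RR_mult_vec inner_add_left inner_add_right inner_commute[of "JJ *v x" x]
      power2_eq_square algebra_simps)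
  then show ?thesis
    by (simp add: ccos_csin_squared norm_eq)
qed

lemma RR_add_mult_vec: "RR (\<theta> + \<theta>') *v x = RR \<theta> *v (RR \<theta>' *v x)"
  by (simp add: RR_mult_vec ccos_add csin_add matrix_vector_right_distrib
    matrix_vector_mult_scaleR algebra_simps)

lemma RR_zero_mult_vec [simp]: "RR 0 *v x = x"
  by (simp add: RR_mult_vec)

lemma BB_mult_component: "(BB \<B> *v x) $ (k, a) = (\<Sum>e\<in>UNIV. \<B> $ k $ e * x $ (e, a))"
proof (cases a rule: exhaust_2[THEN disjE])
qed (simp_all add: BB_def kron_def matrix_vector_mult_def sum_times_2 mat_def)

lemma transpose_BB: "transpose (BB \<B>) = BB (transpose \<B>)"
  by (simp add: BB_def kron_def transpose_def mat_def vec_eq_iff)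

lemma BB_RR_commute: "BB \<B> *v (RR \<theta> *v x) = RR \<theta> *v (BB \<B> *v x)"
  by (simp add: RR_mult_vec vec_times_2_eq_iff BB_mult_component sum.distrib
    sum_distrib_left sum_subtractf sum_negf algebra_simps)

lemma JJ_RR_commute: "JJ *v (RR \<theta> *v x) = RR \<theta> *v (JJ *v x)"
  by (simp add: RR_mult_vec matrix_vector_right_distrib matrix_vector_mult_scaleR)

lemma impedance_RR_commute:
  "(mat r + c *\<^sub>R JJ) *v (RR \<theta> *v x) = RR \<theta> *v ((mat r + c *\<^sub>R JJ) *v x)"
proof -
  have "RR \<theta> *v (r *s x) = r *s (RR \<theta> *v x)" for r
    by (rule vector_scalar_commute)
  then show ?thesis
    by (simp add: matrix_vector_mult_add_rdistrib mat_mult_vec scaleR_matrix_vector_assoc[symmetric]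
      JJ_RR_commute matrix_vector_right_distrib matrix_vector_mult_scaleR)
qed

lemma rvec_component [simp]: "rvec a $ 1 = - csin a" "rvec a $ 2 = ccos a"
  by (simp_all add: rvec_def)

lemma Rot_mult_component: "(Rot \<gamma> *v w) $ (k, a) = rvec (\<gamma> $ k) $ a * w $ k"
  by (simp add: Rot_def matrix_vector_mult_def if_distrib[of "\<lambda>c. c * _"] cong: if_cong)

lemma transpose_Rot_mult_component:
  "(transpose (Rot \<gamma>) *v x) $ k = ccos (\<gamma> $ k) * x $ (k, 2) - csin (\<gamma> $ k) * x $ (k, 1)"
  by (simp add: Rot_def transpose_def matrix_vector_mult_def sum_times_2
    if_distrib[of "\<lambda>c. c * _"] sum.distrib cong: if_cong del: transpose_matrix_vector)

lemma Rot_shift: "Rot (\<gamma> + (\<chi> k. \<theta>)) *v w = RR \<theta> *v (Rot \<gamma> *v w)"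
  by (simp add: vec_times_2_eq_iff RR_mult_vec Rot_mult_component ccos_add csin_add algebra_simps)

text \<open>The vector r(\<gamma>) turns with its angle and rotations are orthogonal, so the two
  rotations cancel through cos^2 + sin^2 = 1.\<close>

lemma transpose_Rot_shift:
  "transpose (Rot (\<gamma> + (\<chi> k. \<theta>))) *v (RR \<theta> *v x) = transpose (Rot \<gamma>) *v x"
proof -
  have "ccos (\<gamma> $ k + \<theta>) * (RR \<theta> *v x) $ (k, 2) - csin (\<gamma> $ k + \<theta>) * (RR \<theta> *v x) $ (k, 1)
      = ((ccos \<theta>)\<^sup>2 + (csin \<theta>)\<^sup>2) * (ccos (\<gamma> $ k) * x $ (k, 2) - csin (\<gamma> $ k) * x $ (k, 1))" for k
    by (simp add: RR_mult_vec ccos_add csin_add power2_eq_square algebra_simps)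
  then show ?thesis
    by (simp add: vec_eq_iff transpose_Rot_mult_component ccos_csin_squared
      del: transpose_matrix_vector)
qed

section \<open>The circle action on states and tangent vectors\<close>

fun rotate_state :: "circle \<Rightarrow> ('n::finite, 'm::finite) state \<Rightarrow> ('n, 'm) state"
  where "rotate_state \<theta> (\<gamma>, w, i, v, l) =
    (\<gamma> + (\<chi> k. \<theta>), w, RR \<theta> *v i, RR \<theta> *v v, RR \<theta> *v l)"

fun rotate_tangent :: "circle \<Rightarrow> ('n::finite, 'm::finite) tangent \<Rightarrow> ('n, 'm) tangent"
  where "rotate_tangent \<theta> (g, w, i, v, l) = (g, w, RR \<theta> *v i, RR \<theta> *v v, RR \<theta> *v l)"

text \<open>The impedances and the incidence matrix act identically in each plane and commute with
  rotations, the coupling \<open>Rot\<close> turns along, and the DC torque is invariant.\<close>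

lemma vf_rotate: "vf P \<B> u (rotate_state \<theta> z) = rotate_tangent \<theta> (vf P \<B> u z)"
  by (cases z) (simp add: Z_R_def Z_C_def Z_l_def impedance_RR_commute Rot_shift transpose_Rot_shift
    transpose_BB BB_RR_commute matrix_vector_mult_scaleR matrix_vector_right_distrib
    matrix_vector_mult_diff_distrib vec.neg del: transpose_matrix_vector)

lemma rotate_state_add: "rotate_state \<theta> (rotate_state \<theta>' z) = rotate_state (\<theta> + \<theta>') z"
  by (cases z) (simp add: RR_add_mult_vec vec_eq_iff add_ac)

lemma rotate_state_0 [simp]: "rotate_state 0 z = z"
  by (cases z) (simp add: vec_eq_iff)

lemma rotate_state_cover_add:
  "rotate_state \<theta> (z + cover h) = rotate_state \<theta> z + cover (rotate_tangent \<theta> h)"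
  by (cases z; cases h) (simp add: vec_eq_iff matrix_vector_right_distrib add_ac)

lemma dist_vec_circle_add_right: "dist (\<gamma> + c) (\<gamma>' + c) = dist \<gamma> (\<gamma>' :: circle^'n)"
  by (simp add: dist_vec_def dist_circle_add_right)

lemma dist_RR_mult_vec: "dist (RR \<theta> *v x) (RR \<theta> *v y) = dist x y"
  by (simp add: dist_norm flip: matrix_vector_mult_diff_distrib)

text \<open>Isometry turns estimates near \<open>zs\<close> into uniform ones along the synchronous
  set.\<close>

lemma dist_rotate_state [simp]: "dist (rotate_state \<theta> z) (rotate_state \<theta> z') = dist z z'"
  by (cases z; cases z') (simp add: dist_Pair_Pair dist_vec_circle_add_right dist_RR_mult_vec)

lemma linear_rotate_tangent: "linear (rotate_tangent \<theta>)"
  by (rule linearI; clarsimp simp: matrix_vector_right_distrib matrix_vector_mult_scaleR)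

lemma linear_coords: "linear coords"
  by (rule linearI) (auto simp: vec_eq_iff split: sum.split)

lemma linear_of_coords: "linear of_coords"
  by (rule linearI) (auto simp: of_coords_def vec_eq_iff)

lemma cover_add: "cover (a + b) = cover a + cover b"
  by (cases a; cases b) (simp add: vec_eq_iff ang_add)

lemma surj_cover: "surj cover"
  unfolding surj_def
proof
  fix z :: "('n::finite, 'm::finite) state"
  obtain \<gamma> w i v l where z: "z = (\<gamma>, w, i, v, l)"
    by (cases z)
  have "\<gamma> = (\<chi> k. ang (inv ang (\<gamma> $ k)))"
    by (simp add: surj_f_inv_f surj_ang vec_eq_iff)
  then show "\<exists>h. z = cover h"
    by (intro exI[of _ "(\<chi> k. inv ang (\<gamma> $ k), w, i, v, l)"]) (simp add: z)
qed

text \<open>\<open>sync_set\<close> resets the DC deviation while \<open>rotate_state\<close> keeps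
  it; the two agree because the deviation is 0.\<close>

lemma sync_set_eq_range: "sync_set (\<gamma>, 0, i, v, l) = range (\<lambda>\<theta>. rotate_state \<theta> (\<gamma>, 0, i, v, l))"
  by (auto simp: image_def)

section \<open>The vector field in a chart\<close>

text \<open>Continuous differentiability through a gradient. The closure rules below let it be
  checked along the syntax of each component of the field.\<close>

definition C1_scalar :: "(real^'n \<Rightarrow> real) \<Rightarrow> bool"
  where "C1_scalar f \<longleftrightarrow>
    (\<exists>g. continuous_on UNIV g \<and> (\<forall>x. (f has_derivative (\<lambda>h. g x \<bullet> h)) (at x)))"

lemma C1_scalar_continuous:
  assumes "C1_scalar f"
  shows "continuous_on UNIV f"
proof -
  obtain g where "\<And>x. (f has_derivative (\<lambda>h. g x \<bullet> h)) (at x)"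
    using assms unfolding C1_scalar_def by blast
  then show ?thesis
    by (intro has_derivative_continuous_on[of UNIV f "\<lambda>x h. g x \<bullet> h"]) simp
qed

lemma C1_scalar_const: "C1_scalar (\<lambda>x. c)"
  unfolding C1_scalar_def by (rule exI[of _ "\<lambda>x. 0"]) (simp add: inner_zero_left[abs_def])

lemma C1_scalar_component: "C1_scalar (\<lambda>x::real^'n. x $ i)"
  unfolding C1_scalar_def
proof (intro exI[of _ "\<lambda>x. axis i 1"] conjI allI)
  have "(\<lambda>h::real^'n. axis i 1 \<bullet> h) = (\<lambda>h. h $ i)"
    by (simp add: fun_eq_iff inner_commute[of "axis i 1"] inner_axis)
  then show "((\<lambda>x::real^'n. x $ i) has_derivative (\<lambda>h. axis i 1 \<bullet> h)) (at x)" for x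
    by (simp only: bounded_linear_imp_has_derivative bounded_linear_vec_nth)
qed simp

lemma C1_scalar_add:
  assumes "C1_scalar f" "C1_scalar f'"
  shows "C1_scalar (\<lambda>x. f x + f' x)"
proof -
  obtain g g' where "continuous_on UNIV g" "\<And>x. (f has_derivative (\<lambda>h. g x \<bullet> h)) (at x)"
    "continuous_on UNIV g'" "\<And>x. (f' has_derivative (\<lambda>h. g' x \<bullet> h)) (at x)"
    using assms unfolding C1_scalar_def by blast
  then show ?thesis
    unfolding C1_scalar_def
    by (intro exI[of _ "\<lambda>x. g x + g' x"])
      (auto intro!: continuous_intros derivative_eq_intros simp: inner_add_left)
qed

lemma C1_scalar_mult:
  assumes "C1_scalar f" "C1_scalar f'"
  shows "C1_scalar (\<lambda>x. f x * f' x)"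
proof -
  obtain g g' where "continuous_on UNIV g" "\<And>x. (f has_derivative (\<lambda>h. g x \<bullet> h)) (at x)"
    "continuous_on UNIV g'" "\<And>x. (f' has_derivative (\<lambda>h. g' x \<bullet> h)) (at x)"
    using assms unfolding C1_scalar_def by blast
  then show ?thesis
    using assms[THEN C1_scalar_continuous]
    unfolding C1_scalar_def
    by (intro exI[of _ "\<lambda>x. f x *\<^sub>R g' x + f' x *\<^sub>R g x"])
      (auto intro!: continuous_intros derivative_eq_intros simp: inner_add_left)
qed

lemma C1_scalar_minus: "C1_scalar f \<Longrightarrow> C1_scalar (\<lambda>x. - f x)"
  using C1_scalar_mult[OF C1_scalar_const[of "-1"]] by simp

lemma C1_scalar_diff: "C1_scalar f \<Longrightarrow> C1_scalar f' \<Longrightarrow> C1_scalar (\<lambda>x. f x - f' x)"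
  using C1_scalar_add[OF _ C1_scalar_minus] by simp

lemma C1_scalar_divide: "C1_scalar f \<Longrightarrow> C1_scalar (\<lambda>x. f x / c)"
  using C1_scalar_mult[OF C1_scalar_const[of "1 / c"]] by simp

lemma C1_scalar_sum: "(\<And>i. i \<in> S \<Longrightarrow> C1_scalar (f i)) \<Longrightarrow> C1_scalar (\<lambda>x. \<Sum>i\<in>S. f i x)"
  by (induction S rule: infinite_finite_induct) (simp_all add: C1_scalar_const C1_scalar_add)

lemma C1_scalar_sin_cos:
  assumes "C1_scalar f"
  shows "C1_scalar (\<lambda>x. sin (f x))" "C1_scalar (\<lambda>x. cos (f x))"
proof -
  obtain g where g: "continuous_on UNIV g" "\<And>x. (f has_derivative (\<lambda>h. g x \<bullet> h)) (at x)"
    using assms unfolding C1_scalar_def by blast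
  note [continuous_intros] = C1_scalar_continuous[OF assms]
  show "C1_scalar (\<lambda>x. sin (f x))"
    unfolding C1_scalar_def using g
    by (intro exI[of _ "\<lambda>x. cos (f x) *\<^sub>R g x"])
      (auto intro!: continuous_intros derivative_eq_intros)
  show "C1_scalar (\<lambda>x. cos (f x))"
    unfolding C1_scalar_def using g
    by (intro exI[of _ "\<lambda>x. - sin (f x) *\<^sub>R g x"])
      (auto intro!: continuous_intros derivative_eq_intros)
qed

lemmas C1_scalar_intros = C1_scalar_const C1_scalar_component C1_scalar_add C1_scalar_mult
  C1_scalar_minus C1_scalar_diff C1_scalar_divide C1_scalar_sum C1_scalar_sin_cos

text \<open>The gradients of the components are the rows of the derivative matrix.\<close>

lemma C1_field_of_components:
  assumes "\<And>i. C1_scalar (\<lambda>x. F x $ i)"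
  obtains M where "C1_field F M"
proof -
  obtain g where g: "\<And>i. continuous_on UNIV (g i)"
    "\<And>i x. ((\<lambda>x. F x $ i) has_derivative (\<lambda>h. g i x \<bullet> h)) (at x)"
    using assms unfolding C1_scalar_def by metis
  have "C1_field F (\<lambda>x. \<chi> i. g i x)"
  proof
    show "(F has_derivative (*v) (\<chi> i. g i x)) (at x)" for x
      using g(2) unfolding has_derivative_componentwise_within[of F]
      by (auto simp: Basis_vec_def inner_axis matrix_vector_mul_component)
    show "continuous_on UNIV (\<lambda>x. \<chi> i. g i x)"
      by (intro continuous_intros g(1))
  qed
  then show ?thesis
    by (rule that)
qed

definition chart_field ::
  "params \<Rightarrow> real^'m^'n \<Rightarrow> real^'n \<Rightarrow> ('n::finite, 'm::finite) state \<Rightarrow>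
   real^('n + 'n + ('n \<times> 2) + ('n \<times> 2) + ('m \<times> 2)) \<Rightarrow>
   real^('n + 'n + ('n \<times> 2) + ('n \<times> 2) + ('m \<times> 2))"
  where "chart_field P \<B> u z x = coords (vf P \<B> u (z + cover (of_coords x)))"

text \<open>In real angles every component is polynomial in the coordinates and in sines and cosines
  of the angles; the case split only exposes each expression to the closure rules.\<close>

lemma C1_scalar_chart_field: "C1_scalar (\<lambda>x. chart_field P \<B> u z x $ s)"
proof -
  obtain \<gamma> w i v l where z: "z = (\<gamma>, w, i, v, l)"
    by (cases z)
  note expand = chart_field_def z of_coords_def transpose_Rot_mult_component Rot_mult_component
    ccos_add csin_add
  show ?thesis
  proof (cases s)
    case (Inl k)
    then show ?thesis
      by (simp add: expand) (intro C1_scalar_intros)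
  next
    case (Inr s1)
    show ?thesis
    proof (cases s1)
      case (Inl k)
      with Inr show ?thesis
        by (simp add: expand del: transpose_matrix_vector) (intro C1_scalar_intros)
    next
      case s1: (Inr s2)
      show ?thesis
      proof (cases s2)
        case (Inl p)
        obtain k a where "p = (k, a)"
          by (cases p)
        with Inl s1 Inr have s: "s = Inr (Inr (Inl (k, a)))"
          by simp
        consider "a = 1" | "a = 2"
          using exhaust_2[of a] by blast
        then show ?thesis
        proof cases
          case 1
          then show ?thesis
            by (simp add: s expand) (simp add: matrix_vector_mult_def, intro C1_scalar_intros)
        next
          case 2
          then show ?thesis
            by (simp add: s expand) (simp add: matrix_vector_mult_def, intro C1_scalar_intros)
        qed
      next
        case s2: (Inr s3)
        show ?thesis
        proof (cases s3)
          case (Inl p)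
          with s2 s1 Inr show ?thesis
            by (simp add: expand matrix_vector_mult_def) (intro C1_scalar_intros)
        next
          case (Inr q)
          with s2 s1 \<open>s = Inr s1\<close> show ?thesis
            by (simp add: expand matrix_vector_mult_def del: transpose_matrix_vector) (intro C1_scalar_intros)
        qed
      qed
    qed
  qed
qed

lemma state_jacobian_eq:
  assumes "C1_field (chart_field P \<B> u z) M"
  shows "state_jacobian P \<B> u z = M 0"
proof -
  have "coords \<circ> (\<lambda>h. vf P \<B> u (z + cover h)) \<circ> of_coords = chart_field P \<B> u z"
    by (simp add: fun_eq_iff chart_field_def)
  then show ?thesis
    using frechet_derivative_at[OF C1_field.F_deriv[OF assms], of 0, symmetric]
    by (simp add: state_jacobian_def jacobian_def)
qed

section \<open>Correspondence between the chart and the state space\<close>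

lemma tendsto_chart:
  assumes "(c \<longlongrightarrow> x) G"
  shows "((\<lambda>t. z + cover (of_coords (c t))) \<longlongrightarrow> z + cover (of_coords x)) G"
proof -
  obtain \<gamma> w i v l where z: "z = (\<gamma>, w, i, v, l)"
    by (cases z)
  have "((\<lambda>t. \<gamma> + (\<chi> k. ang (c t $ Inl k))) \<longlongrightarrow> \<gamma> + (\<chi> k. ang (x $ Inl k))) G"
    by (rule vec_tendstoI)
      (simp add: tendsto_circle_iff unit_complex_add cis_conv_exp,
        intro tendsto_intros assms)
  then show ?thesis
    unfolding z of_coords_def by (simp, intro tendsto_intros assms)
qed

text \<open>Small angle differences are lifted one by one to small reals; the other components are
  differences of vectors.\<close>

lemma chart_lift:
  fixes z :: "('n::finite, 'm::finite) state"
  assumes "\<delta> > 0"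
  obtains d where "d > 0" "\<And>z'. dist z' z < d \<Longrightarrow> \<exists>x. norm x \<le> \<delta> \<and> z' = z + cover (of_coords x)"
proof -
  obtain K where K: "K > 0" "\<And>h::('n, 'm) tangent. norm (coords h) \<le> K * norm h"
    using linear_bounded_pos[OF linear_coords] by blast
  \<comment> \<open>One term for each lifted angle and one for each of the four remaining blocks,
    each below \<open>e\<close>.\<close>
  define N where "N = real CARD('n) + 4"
  have N: "N > 0"
    by (simp add: N_def)
  define e where "e = \<delta> / (K * N)"
  have e: "e > 0" "K * (N * e) = \<delta>"
    using assms K N by (simp_all add: e_def)
  obtain d where d: "d > 0" "\<And>a b. dist a b < d \<Longrightarrow> \<exists>x. \<bar>x\<bar> < e \<and> a = b + ang x"
    by (rule circle_lift_small[OF e(1)]) (rule that)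
  have "\<exists>x. norm x \<le> \<delta> \<and> z' = z + cover (of_coords x)" if "dist z' z < min d e" for z'
  proof -
    obtain \<gamma> w i v l where z: "z = (\<gamma>, w, i, v, l)"
      by (cases z)
    obtain \<gamma>' w' i' v' l' where z': "z' = (\<gamma>', w', i', v', l')"
      by (cases z')
    have dist: "dist \<gamma>' \<gamma> < min d e" "dist w' w < min d e" "dist i' i < min d e" "dist v' v < min d e"
      "dist l' l < min d e"
      using that dist_fst_le[of z' z] dist_snd_le[of z' z] dist_fst_le[of "snd z'" "snd z"] dist_snd_le[of "snd z'" "snd z"]
        dist_fst_le[of "snd (snd z')" "snd (snd z)"] dist_snd_le[of "snd (snd z')" "snd (snd z)"]
        dist_fst_le[of "snd (snd (snd z'))" "snd (snd (snd z))"] dist_snd_le[of "snd (snd (snd z'))" "snd (snd (snd z))"]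
      by (simp_all add: z z')
    have "\<exists>x. \<bar>x\<bar> < e \<and> \<gamma>' $ k = \<gamma> $ k + ang x" for k
      using d(2) dist_vec_nth_le[of \<gamma>' k \<gamma>] dist(1) by simp
    then obtain g where g: "\<And>k. \<bar>g k\<bar> < e" "\<And>k. \<gamma>' $ k = \<gamma> $ k + ang (g k)"
      by metis
    define h where "h = (\<chi> k. g k, w' - w, i' - i, v' - v, l' - l)"
    have "norm (\<chi> k. g k) \<le> (\<Sum>k\<in>UNIV. \<bar>g k\<bar>)"
      using norm_le_l1_cart[of "\<chi> k. g k"] by simp
    also have "\<dots> \<le> real CARD('n) * e"
      using sum_bounded_above[of UNIV "\<lambda>k. \<bar>g k\<bar>" e] g(1) by (simp add: less_imp_le)
    finally have "norm h \<le> N * e"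
      using dist norm_Pair_le[of "\<chi> k. g k" "(w' - w, i' - i, v' - v, l' - l)"]
        norm_Pair_le[of "w' - w" "(i' - i, v' - v, l' - l)"] norm_Pair_le[of "i' - i" "(v' - v, l' - l)"]
        norm_Pair_le[of "v' - v" "l' - l"]
      by (simp add: h_def N_def dist_norm algebra_simps)
    then have "norm (coords h) \<le> \<delta>"
      using K(2)[of h] mult_left_mono[of "norm h" "N * e" K] K(1) e(2) by linarith
    moreover have "z' = z + cover h"
      by (simp add: z z' h_def vec_eq_iff g(2))
    ultimately show ?thesis
      by (intro exI[of _ "coords h"]) simp
  qed
  then show ?thesis
    using d(1) e(1) by (intro that[of "min d e"]) simp_all
qed

lemma rotate_state_cancel [simp]:
  "rotate_state \<theta> (rotate_state (- \<theta>) z) = z" "rotate_state (- \<theta>) (rotate_state \<theta> z) = z"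
  by (simp_all add: rotate_state_add)

text \<open>A lift of the solution is fixed only up to full turns, so \<open>c\<close> adds its
  increments \<open>y t - y 0\<close>, rotated back, to the prescribed start \<open>x\<close>.
  Equivariance turns the velocity into that of the chart field.\<close>

lemma solution_in_chart:
  assumes z: "solution P \<B> u z" and z0: "z 0 = rotate_state \<theta> (z0 + cover (of_coords x))"
  obtains c where "c 0 = x" "\<And>t. t \<ge> 0 \<Longrightarrow> z t = rotate_state \<theta> (z0 + cover (of_coords (c t)))"
    "\<forall>t\<ge>0. (c has_vector_derivative chart_field P \<B> u z0 (c t)) (at t within {0..})"
proof -
  obtain y where y: "\<And>t. t \<ge> 0 \<Longrightarrow> z t = cover (y t)"
    "\<And>t. t \<ge> 0 \<Longrightarrow> (y has_vector_derivative vf P \<B> u (z t)) (at t within {0..})"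
    using z unfolding solution_def by blast
  define c where "c t = x + coords (rotate_tangent (- \<theta>) (y t - y 0))" for t
  have zt: "rotate_state (- \<theta>) (z t) = z0 + cover (of_coords (c t))" if "t \<ge> 0" for t
  proof -
    have "z t = z 0 + cover (y t - y 0)"
      using y(1) that by (simp flip: cover_add)
    then have "rotate_state (- \<theta>) (z t) =
        rotate_state (- \<theta>) (z 0) + cover (rotate_tangent (- \<theta>) (y t - y 0))"
      by (simp only: rotate_state_cover_add)
    then show ?thesis
      by (simp add: z0 rotate_state_add c_def linear_add[OF linear_of_coords] cover_add add.assoc)
  qed
  show ?thesis
  proof (rule that)
    show "c 0 = x"
      by (simp add: c_def linear_0[OF linear_rotate_tangent] linear_0[OF linear_coords])
    show "z t = rotate_state \<theta> (z0 + cover (of_coords (c t)))" if "t \<ge> 0" for t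
      using zt[OF that] by (metis rotate_state_cancel(1))
    have lin: "bounded_linear (\<lambda>h. coords (rotate_tangent (- \<theta>) h))"
      using linear_compose[OF linear_rotate_tangent linear_coords]
      by (simp add: linear_conv_bounded_linear o_def)
    show "\<forall>t\<ge>0. (c has_vector_derivative chart_field P \<B> u z0 (c t)) (at t within {0..})"
    proof (intro allI impI)
      fix t :: real
      assume t: "0 \<le> t"
      have "(c has_vector_derivative (0 + coords (rotate_tangent (- \<theta>) (vf P \<B> u (z t) - 0)))) (at t within {0..})"
        unfolding c_def
        by (intro has_vector_derivative_add has_vector_derivative_const
          bounded_linear.has_vector_derivative[OF lin] has_vector_derivative_diff y(2) t)
      then show "(c has_vector_derivative chart_field P \<B> u z0 (c t)) (at t within {0..})"
        by (simp add: chart_field_def vf_rotate[symmetric] zt[OF t])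
    qed
  qed
qed

text \<open>A lift is obtained by adding the rotated chart trajectory to any lift of the base
  point.\<close>

lemma solution_of_chart:
  assumes c: "\<forall>t\<ge>0. (c has_vector_derivative chart_field P \<B> u z0 (c t)) (at t within {0..})"
  shows "solution P \<B> u (\<lambda>t. rotate_state \<theta> (z0 + cover (of_coords (c t))))"
proof -
  obtain y0 where y0: "rotate_state \<theta> z0 = cover y0"
    using surj_cover by (metis surj_def)
  define y where "y t = y0 + rotate_tangent \<theta> (of_coords (c t))" for t
  have lin: "bounded_linear (\<lambda>x. rotate_tangent \<theta> (of_coords x))"
    using linear_compose[OF linear_of_coords linear_rotate_tangent]
    by (simp add: linear_conv_bounded_linear o_def)
  have "(y has_vector_derivative vf P \<B> u (rotate_state \<theta> (z0 + cover (of_coords (c t))))) (at t within {0..})"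
    if "t \<ge> 0" for t
  proof -
    have "(y has_vector_derivative 0 + rotate_tangent \<theta> (of_coords (chart_field P \<B> u z0 (c t)))) (at t within {0..})"
      unfolding y_def using c that
      by (intro has_vector_derivative_add has_vector_derivative_const
        bounded_linear.has_vector_derivative[OF lin]) auto
    then show ?thesis
      by (simp add: chart_field_def vf_rotate)
  qed
  moreover have "rotate_state \<theta> (z0 + cover (of_coords (c t))) = cover (y t)" for t
    by (simp add: y_def rotate_state_cover_add y0 cover_add)
  ultimately show ?thesis
    unfolding solution_def by blast
qed

lemma infdist_less_obtain:
  assumes "infdist x S < e" "S \<noteq> {}"
  obtains s where "s \<in> S" "dist x s < e"
  using cInf_lessD[of "dist x ` S" e] assms by (auto simp: infdist_def)

theorem mainTheorem1:
  fixes P :: params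
    and \<B> :: "real^'m^'n"
    and u :: "real^'n"
    and zs :: "('n, 'm) state"
    and \<gamma> :: "circle^'n"
    and i v :: "real^('n \<times> 2)"
    and l :: "real^('m \<times> 2)"
  assumes params: "admissible P"
    and graph: "incidence_matrix \<B>"
    and input: "u \<in> feasible_inputs P \<B>"
    and zs: "zs = (\<gamma>, 0, i, v, l)"
    and equilibrium: "zs \<in> equilibria P \<B> u"
    and simple_zero: "alg_mult (state_jacobian P \<B> u zs) 0 = 1"
    and other_eigenvalues: "\<And>c. eigenvalue (state_jacobian P \<B> u zs) c \<Longrightarrow> c \<noteq> 0 \<Longrightarrow> Re c < 0"
  shows "set_asymptotically_stable (solution P \<B> u) (sync_set zs) \<and>
    (\<exists>D. open D \<and> sync_set zs \<subseteq> D \<and>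
      (\<forall>z0\<in>D. (\<exists>z. solution P \<B> u z \<and> z 0 = z0) \<and>
        (\<forall>z. solution P \<B> u z \<and> z 0 = z0 \<longrightarrow> (\<exists>s\<in>sync_set zs. (z \<longlongrightarrow> s) at_top))))"
proof -
  let ?S = "sync_set zs"
  let ?F = "chart_field P \<B> u zs"
  let ?chart = "\<lambda>x. zs + cover (of_coords x)"
  have S: "?S = range (\<lambda>\<theta>. rotate_state \<theta> zs)"
    unfolding zs by (rule sync_set_eq_range)
  then have S_ne: "?S \<noteq> {}"
    by simp
  \<comment> \<open>The curve \<phi> is the orbit of \<open>zs\<close> seen in the chart: angles
    advance by s, and the AC part moves by R(s) x - x = (cos s - 1) x + sin s J x. Its tangent at 0
    is \<open>e1 + Y\<close>.\<close>
  define e1 :: "real^('n + 'n + ('n \<times> 2) + ('n \<times> 2) + ('m \<times> 2))"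
    where "e1 = coords (1, 0, 0, 0, 0)"
  define X :: "real^('n + 'n + ('n \<times> 2) + ('n \<times> 2) + ('m \<times> 2))"
    where "X = coords (0, 0, i, v, l)"
  define Y :: "real^('n + 'n + ('n \<times> 2) + ('n \<times> 2) + ('m \<times> 2))"
    where "Y = coords (0, 0, JJ *v i, JJ *v v, JJ *v l)"
  define \<phi> where "\<phi> s = s *\<^sub>R e1 + (cos s - 1) *\<^sub>R X + sin s *\<^sub>R Y" for s
  have chart_\<phi>: "?chart (\<phi> s) = rotate_state (ang s) zs" for s
  proof -
    have "of_coords (\<phi> s) = s *\<^sub>R (1, 0, 0, 0, 0) + (cos s - 1) *\<^sub>R (0, 0, i, v, l) +
        sin s *\<^sub>R (0, 0, JJ *v i, JJ *v v, JJ *v l)"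
      by (simp add: \<phi>_def e1_def X_def Y_def linear_add[OF linear_of_coords] linear_scale[OF linear_of_coords]
        del: coords.simps)
    then show ?thesis
      by (simp add: zs RR_mult_vec vec_eq_iff algebra_simps)
  qed
  obtain M where "C1_field ?F M"
    using C1_field_of_components[of ?F] C1_scalar_chart_field by blast
  then interpret C1_field ?F M .
  have M0: "M 0 = state_jacobian P \<B> u zs"
    by (rule state_jacobian_eq[symmetric]) fact
  interpret equilibrium_curve ?F M \<phi> "e1 + Y"
  proof
    show "\<phi> 0 = 0"
      by (simp add: \<phi>_def)
    show "?F (\<phi> s) = 0" for s
      using equilibrium
      by (simp add: chart_field_def chart_\<phi> vf_rotate equilibria_def linear_0[OF linear_rotate_tangent]
        linear_0[OF linear_coords])
    show "continuous_on UNIV \<phi>"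
      unfolding \<phi>_def by (intro continuous_intros)
    show "(\<phi> has_vector_derivative e1 + Y) (at 0)"
      unfolding \<phi>_def by (auto intro!: derivative_eq_intros)
    have "(e1 + Y) $ Inl k = 1" for k
      by (simp add: e1_def Y_def)
    then show "e1 + Y \<noteq> 0"
      by (metis zero_index zero_neq_one)
  qed (use simple_zero other_eigenvalues in \<open>simp_all add: M0\<close>)
  \<comment> \<open>One tube radius provides existence, the bound for stability, and convergence to
    a point of the set.\<close>
  have tube: "\<exists>d>0. (\<forall>z0. infdist z0 ?S < d \<longrightarrow> (\<exists>z. solution P \<B> u z \<and> z 0 = z0)) \<and>
      (\<forall>z. solution P \<B> u z \<and> infdist (z 0) ?S < d \<longrightarrow>
        (\<forall>t\<ge>0. infdist (z t) ?S < \<epsilon>) \<and> (\<exists>s\<in>?S. (z \<longlongrightarrow> s) at_top))" if \<epsilon>: "\<epsilon> > 0" for \<epsilon>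
  proof -
    have "(?chart \<longlongrightarrow> ?chart 0) (nhds 0)"
      by (rule tendsto_chart) (rule filterlim_ident)
    moreover have "?chart 0 = zs"
      using chart_\<phi>[of 0] by (simp add: \<phi>_def)
    ultimately obtain \<rho> where \<rho>: "\<rho> > 0" "\<And>x. norm x < \<rho> \<Longrightarrow> dist (?chart x) zs < \<epsilon>"
      using tendstoD[OF _ \<epsilon>] by (force simp: eventually_nhds_metric dist_norm)
    obtain \<delta> where \<delta>: "\<delta> > 0"
      "\<And>c. norm (c 0) \<le> \<delta> \<Longrightarrow> \<forall>t\<ge>0. (c has_vector_derivative ?F (c t)) (at t within {0..}) \<Longrightarrow>
        (\<forall>t\<ge>0. norm (c t) < \<rho>) \<and> (\<exists>s. (c \<longlongrightarrow> \<phi> s) at_top)"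
      "\<And>x. norm x \<le> \<delta> \<Longrightarrow> \<exists>c. c 0 = x \<and> (\<forall>t\<ge>0. (c has_vector_derivative ?F (c t)) (at t within {0..}))"
      by (rule attraction[OF \<rho>(1)]) (rule that)
    obtain d where d: "d > 0" "\<And>z'. dist z' zs < d \<Longrightarrow> \<exists>x. norm x \<le> \<delta> \<and> z' = ?chart x"
      by (rule chart_lift[OF \<delta>(1)]) (rule that)
    \<comment> \<open>A point of the orbit within distance \<open>d\<close> is rotated back to
      \<open>zs\<close>, where the chart covers the rotated state.\<close>
    have lift: "\<exists>\<theta> x. norm x \<le> \<delta> \<and> z0 = rotate_state \<theta> (?chart x)" if z0: "infdist z0 ?S < d" for z0
    proof -
      obtain s where s: "s \<in> ?S" "dist z0 s < d"
        by (rule infdist_less_obtain[OF z0 S_ne])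
      then obtain \<theta> where "dist z0 (rotate_state \<theta> zs) < d"
        unfolding S by (elim rangeE) simp
      then have "dist (rotate_state (- \<theta>) z0) zs < d"
        using dist_rotate_state[of \<theta> "rotate_state (- \<theta>) z0" zs] by (simp del: dist_rotate_state)
      then obtain x where x: "norm x \<le> \<delta>" "rotate_state (- \<theta>) z0 = ?chart x"
        using d(2) by blast
      have "z0 = rotate_state \<theta> (?chart x)"
        by (simp flip: x(2))
      then show ?thesis
        using x(1) by blast
    qed
    have "\<exists>z. solution P \<B> u z \<and> z 0 = z0" if z0: "infdist z0 ?S < d" for z0
    proof -
      obtain \<theta> x where x: "norm x \<le> \<delta>" "z0 = rotate_state \<theta> (?chart x)"
        using lift[OF z0] by blast
      obtain c where "c 0 = x" "\<forall>t\<ge>0. (c has_vector_derivative ?F (c t)) (at t within {0..})"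
        using \<delta>(3)[OF x(1)] by blast
      then show ?thesis
        using solution_of_chart[of c P \<B> u zs \<theta>] x(2)
        by (intro exI[of _ "\<lambda>t. rotate_state \<theta> (?chart (c t))"]) simp
    qed
    moreover have "(\<forall>t\<ge>0. infdist (z t) ?S < \<epsilon>) \<and> (\<exists>s\<in>?S. (z \<longlongrightarrow> s) at_top)"
      if z: "solution P \<B> u z" "infdist (z 0) ?S < d" for z
    proof -
      obtain \<theta> x where x: "norm x \<le> \<delta>" "z 0 = rotate_state \<theta> (?chart x)"
        using lift[OF z(2)] by blast
      obtain c where c: "c 0 = x" "\<And>t. t \<ge> 0 \<Longrightarrow> z t = rotate_state \<theta> (?chart (c t))"
        "\<forall>t\<ge>0. (c has_vector_derivative ?F (c t)) (at t within {0..})"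
        by (rule solution_in_chart[OF z(1) x(2)]) (rule that)
      have near: "norm (c t) < \<rho>" if "t \<ge> 0" for t
        using \<delta>(2)[of c] c x(1) that by blast
      obtain s where s: "(c \<longlongrightarrow> \<phi> s) at_top"
        using \<delta>(2)[of c] c x(1) by blast
      have near_S: "infdist (z t) ?S < \<epsilon>" if "t \<ge> 0" for t
      proof -
        have "infdist (z t) ?S \<le> dist (z t) (rotate_state \<theta> zs)"
          by (rule infdist_le) (simp add: S)
        also have "\<dots> < \<epsilon>"
          using \<rho>(2)[OF near[OF that]] c(2)[OF that] by simp
        finally show ?thesis .
      qed
      \<comment> \<open>The chart limit \<phi> s is the rotation of \<open>zs\<close> by s, and the
        rotation by \<theta> that was undone is added back.\<close>
      have conv: "(z \<longlongrightarrow> rotate_state (\<theta> + ang s) zs) at_top"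
      proof -
        have "((\<lambda>t. dist (?chart (c t)) (?chart (\<phi> s))) \<longlongrightarrow> 0) at_top"
          by (rule tendsto_dist_iff[THEN iffD1, OF tendsto_chart[OF s]])
        moreover have "\<forall>\<^sub>F t in at_top. dist (?chart (c t)) (?chart (\<phi> s)) =
            dist (z t) (rotate_state (\<theta> + ang s) zs)"
          by (rule eventually_at_top_linorderI[of 0])
            (simp only: c(2) chart_\<phi> dist_rotate_state flip: rotate_state_add)
        ultimately have "((\<lambda>t. dist (z t) (rotate_state (\<theta> + ang s) zs)) \<longlongrightarrow> 0) at_top"
          by (rule Lim_transform_eventually)
        then show ?thesis
          by (rule tendsto_dist_iff[THEN iffD2])
      qed
      have "rotate_state (\<theta> + ang s) zs \<in> ?S"
        by (simp add: S)
      with near_S conv show ?thesis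
        by (intro conjI allI impI bexI)
    qed
    ultimately show ?thesis
      using d(1) by (intro exI[of _ d]) simp
  qed
  have stable_S: "set_stable (solution P \<B> u) ?S"
    unfolding set_stable_def
  proof (intro allI impI)
    fix \<epsilon> :: real
    assume "\<epsilon> > 0"
    obtain d where "d > 0" "\<forall>z. solution P \<B> u z \<and> infdist (z 0) ?S < d \<longrightarrow>
        (\<forall>t\<ge>0. infdist (z t) ?S < \<epsilon>) \<and> (\<exists>s\<in>?S. (z \<longlongrightarrow> s) at_top)"
      using tube[OF \<open>\<epsilon> > 0\<close>] by (elim exE conjE) (rule that)
    then show "\<exists>\<delta>>0. \<forall>z. solution P \<B> u z \<and> infdist (z 0) ?S \<le> \<delta> \<longrightarrow> (\<forall>t\<ge>0. infdist (z t) ?S < \<epsilon>)"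
      \<comment> \<open>Halving passes from the strict bound of the tube to the non-strict one in
        \<open>set_stable\<close>.\<close>
      by (intro exI[of _ "d / 2"]) simp
  qed
  obtain d where d: "d > 0" "\<And>z0. infdist z0 ?S < d \<Longrightarrow> \<exists>z. solution P \<B> u z \<and> z 0 = z0"
    "\<And>z. solution P \<B> u z \<Longrightarrow> infdist (z 0) ?S < d \<Longrightarrow> \<exists>s\<in>?S. (z \<longlongrightarrow> s) at_top"
    using tube[OF zero_less_one] by (elim exE conjE) (rule that, auto)
  define D where "D = {z. infdist z ?S < d}"
  have D: "open D" "?S \<subseteq> D"
    unfolding D_def using d(1) by (auto intro!: open_Collect_less continuous_intros)
  have attractive: "((\<lambda>t. infdist (z t) ?S) \<longlongrightarrow> 0) at_top" if z: "solution P \<B> u z" "z 0 \<in> D" for z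
  proof -
    obtain s where s: "s \<in> ?S" "(z \<longlongrightarrow> s) at_top"
      using d(3)[OF z(1)] z(2) unfolding D_def by blast
    then show ?thesis
      using tendsto_infdist[OF s(2), of ?S] by simp
  qed
  have "set_asymptotically_stable (solution P \<B> u) ?S"
    unfolding set_asymptotically_stable_def
    by (intro conjI exI[of _ D] allI impI stable_S D attractive) simp_all
  moreover have "(\<exists>z. solution P \<B> u z \<and> z 0 = z0) \<and>
      (\<forall>z. solution P \<B> u z \<and> z 0 = z0 \<longrightarrow> (\<exists>s\<in>?S. (z \<longlongrightarrow> s) at_top))" if "z0 \<in> D" for z0
    using d(2,3) that unfolding D_def mem_Collect_eq by metis
  ultimately show ?thesis
    using D by (intro conjI exI[of _ D] ballI) simp_all
qed

end
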